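(* Let $\mu_n=\mu_n^{\mathrm{ball}(\alpha,d)}$ with $0<\alpha<d$ and let $A$ be the associated random cutout set. Almost surely, $\overline{\dim}_B(E\cap A)\le\dim_HE-\alpha$ for every self-similar set $E\subset\mathbb{R}^d$ with $\dim_HE>\alpha$ satisfying the open set condition.
   Context: Ball cutout $\mu_n^{\mathrm{ball}(\alpha,d)}$: let $r>0$ and let $\mathcal{Y}$ be a Poisson point process of balls whose intensity is the push-forward of $r\,\mathcal{L}^d\times\frac{ds}{s}$ on $\mathbb{R}^d\times(0,\infty)$ under $(t,s)\mapsto B(st,s/2)$. Set $A_n=B(0,1)\setminus\bigcup\{B\in\mathcal{Y}:2^{-n}\le\operatorname{diam}B<1\}$, $\alpha=r\,\mathcal{L}^d(B(0,1/2))$, $\mu_n=2^{\alpha n}\mathbf{1}_{A_n}$, and $A=\overline{\bigcap_nA_n}$. A self-similar set is the attractor of a finite iterated function system of contracting similarities of $\mathbb{R}^d$. *)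

theory Defs
  imports "HOL-Probability.Probability"
begin

definition poisson_point_process ::
  "'w measure \<Rightarrow> 'a::topological_space measure \<Rightarrow> ('w \<Rightarrow> 'a set) \<Rightarrow> bool" where
  "poisson_point_process M \<nu> Y \<longleftrightarrow>
     prob_space M \<and> sets \<nu> = sets borel \<and>
     (\<forall>B \<in> sets borel. emeasure \<nu> B < \<infinity> \<longrightarrow>
        (AE \<omega> in M. finite (Y \<omega> \<inter> B)) \<and>
        (\<lambda>\<omega>. card (Y \<omega> \<inter> B)) \<in> measurable M (count_space UNIV) \<and>
        (\<forall>k::nat. measure M {\<omega> \<in> space M. card (Y \<omega> \<inter> B) = k}
                  = measure \<nu> B ^ k / fact k * exp (- measure \<nu> B))) \<and>
     (\<forall>(I::nat set) (B::nat \<Rightarrow> 'a set). finite I \<longrightarrow>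
        (\<forall>i\<in>I. B i \<in> sets borel \<and> emeasure \<nu> (B i) < \<infinity>) \<longrightarrow>
        disjoint_family_on B I \<longrightarrow>
        prob_space.indep_vars M (\<lambda>_. count_space (UNIV::nat set))
           (\<lambda>i \<omega>. card (Y \<omega> \<inter> B i)) I)"

text \<open>Intensity r * Lebesgue(dt) * ds/s on R^d x (0,oo); the point (t,s) corresponds to
the ball B(s t, s/2) of diameter s.\<close>

definition ball_cutout_intensity :: "real \<Rightarrow> ('a::euclidean_space \<times> real) measure" where
  "ball_cutout_intensity r =
     density lborel (\<lambda>(t, s). if 0 < s then ennreal (r / s) else 0)"

definition ball_of :: "'a::euclidean_space \<times> real \<Rightarrow> 'a set" where
  "ball_of p = ball (snd p *\<^sub>R fst p) (snd p / 2)"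

definition cutout_An :: "('a::euclidean_space \<times> real) set \<Rightarrow> nat \<Rightarrow> 'a set" where
  "cutout_An Y n = ball 0 1 - \<Union> {ball_of p | p. p \<in> Y \<and> (1/2) ^ n \<le> snd p \<and> snd p < 1}"

definition cutout_A :: "('a::euclidean_space \<times> real) set \<Rightarrow> 'a set" where
  "cutout_A Y = closure (\<Inter> n. cutout_An Y n)"

definition ball_cutout_alpha :: "real \<Rightarrow> 'a::euclidean_space itself \<Rightarrow> real" where
  "ball_cutout_alpha r _ = r * measure (lborel :: 'a measure) (ball 0 (1/2))"

definition hausdorff_pre :: "real \<Rightarrow> real \<Rightarrow> 'a::metric_space set \<Rightarrow> ennreal" where
  "hausdorff_pre s \<delta> E =
     (INF U \<in> {U :: nat \<Rightarrow> 'a set. E \<subseteq> (\<Union>i. U i) \<and>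
                 (\<forall>i. bounded (U i) \<and> diameter (U i) \<le> \<delta>)}.
        (\<Sum>i. ennreal (diameter (U i) powr s)))"

definition hausdorff_measure :: "real \<Rightarrow> 'a::metric_space set \<Rightarrow> ennreal" where
  "hausdorff_measure s E = (SUP \<delta> \<in> {0<..}. hausdorff_pre s \<delta> E)"

definition hausdorff_dim :: "'a::metric_space set \<Rightarrow> real" where
  "hausdorff_dim E = Inf {s. 0 < s \<and> hausdorff_measure s E = 0}"

definition covering_number :: "'a::metric_space set \<Rightarrow> real \<Rightarrow> nat" where
  "covering_number E \<delta> =
     Inf {card C | C. finite C \<and> E \<subseteq> \<Union>C \<and> (\<forall>U\<in>C. bounded U \<and> diameter U \<le> \<delta>)}"

definition upper_box_dim :: "'a::metric_space set \<Rightarrow> ereal" where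
  "upper_box_dim E =
     (if E = {} then - \<infinity>
      else Limsup (at_right 0) (\<lambda>\<delta>. ereal (ln (real (covering_number E \<delta>)) / - ln \<delta>)))"

definition contracting_similarity :: "('a::metric_space \<Rightarrow> 'a) \<Rightarrow> bool" where
  "contracting_similarity f \<longleftrightarrow> (\<exists>\<rho>. 0 < \<rho> \<and> \<rho> < 1 \<and> (\<forall>x y. dist (f x) (f y) = \<rho> * dist x y))"

definition ifs_attractor :: "('a::metric_space \<Rightarrow> 'a) list \<Rightarrow> 'a set \<Rightarrow> bool" where
  "ifs_attractor fs E \<longleftrightarrow> compact E \<and> E \<noteq> {} \<and> E = (\<Union>f \<in> set fs. f ` E)"

definition open_set_condition :: "('a::metric_space \<Rightarrow> 'a) list \<Rightarrow> bool" where
  "open_set_condition fs \<longleftrightarrow> (\<exists>V. open V \<and> V \<noteq> {} \<and> (\<forall>f \<in> set fs. f ` V \<subseteq> V) \<and>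
     (\<forall>i < length fs. \<forall>j < length fs. i \<noteq> j \<longrightarrow> (fs ! i) ` V \<inter> (fs ! j) ` V = {}))"

definition self_similar_osc :: "'a::metric_space set \<Rightarrow> bool" where
  "self_similar_osc E \<longleftrightarrow> (\<exists>fs. fs \<noteq> [] \<and> (\<forall>f \<in> set fs. contracting_similarity f) \<and>
     ifs_attractor fs E \<and> open_set_condition fs)"

end

(* Let h(t) be the probability, up to constants, that a point at distance t from a given surviving
   point survives the cutout down to scale b: the balls of diameter s < t that hit one of the two
   points cannot hit the other, so h(t) is about (b/t)^alpha.  Removing points one at a time bounds
   the k-th moment of the number of surviving points of a b-net P by (k H)^k, where H bounds the sum
   of h(|p - x|) over p in P.  A self-similar set of dimension s with the open set condition has
   upper regular b-nets, so H is at most of order log(1/b) b^(alpha - s) when s > alpha.  Self-similar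
   sets given by m maps form a finite-dimensional family, which at scale b is exhausted by polynomially
   many sets; taking k large, Markov's inequality beats this number, and Borel-Cantelli applies
   simultaneously to all of them.  Only void probabilities of the Poisson process enter. *)
theory Submission
  imports Defs "HOL-Real_Asymp.Real_Asymp"
begin

section \<open>Similarities\<close>

text \<open>A surviving point z of E is in general no net point, and the net comes from a nearby set
  E', so survival has to be transferred from z to a net point p with dist p z < 2a. Each ball of
  diameter s is therefore replaced by the concentric ball of radius \<beta> s with \<beta> < 1/2: if
  2a <= (1/2 - \<beta>) b and s >= b, a ball whose shrunken copy contains p contains z. The price is
  the exponent r vol B(0,\<beta>) in place of \<alpha>, restored by letting \<beta> tend to 1/2. An
  almost sure statement about uncountably many E must be reduced to countably many events. The
  classes \<open>ss_class m K s\<close> with natural m, K and rational s do this. Their finite nets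
  consist of members of the class, because a rounded system of maps may violate the open set
  condition and lose the regularity constant that the moment bound needs. Hausdorff dimension is
  tied to counting by the inequality s0 <= dim for the Moran exponent s0. A counting form of the
  mass distribution principle proves it without constructing a measure on E.\<close>

definition similarity :: "real \<Rightarrow> ('a::metric_space \<Rightarrow> 'a) \<Rightarrow> bool" where
  "similarity \<rho> f \<longleftrightarrow> 0 < \<rho> \<and> (\<forall>x y. dist (f x) (f y) = \<rho> * dist x y)"

lemma similarityD:
  assumes "similarity \<rho> f"
  shows "0 < \<rho>" "dist (f x) (f y) = \<rho> * dist x y"
  using assms unfolding similarity_def by auto

text \<open>Normalised by its value at 0 and its ratio, a similarity is an isometry fixing 0, hence
  linear. Linearity supplies surjectivity, so that images of balls are full balls, and the affine
  coordinates of \<open>similarity_affine\<close>.\<close>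

lemma similarity_orthogonal:
  fixes f :: "'a::euclidean_space \<Rightarrow> 'a"
  assumes "similarity \<rho> f"
  shows "orthogonal_transformation (\<lambda>x. (f x - f 0) /\<^sub>R \<rho>)"
proof -
  have "dist ((f x - f 0) /\<^sub>R \<rho>) ((f y - f 0) /\<^sub>R \<rho>) = dist x y" for x y
  proof -
    have "dist ((f x - f 0) /\<^sub>R \<rho>) ((f y - f 0) /\<^sub>R \<rho>) = norm (((f x - f 0) - (f y - f 0)) /\<^sub>R \<rho>)"
      by (simp only: dist_norm scaleR_diff_right)
    also have "\<dots> = dist (f x) (f y) / \<rho>"
      using similarityD[OF assms] by (simp add: dist_norm)
    finally show ?thesis using similarityD[OF assms] by simp
  qed
  then show ?thesis by (simp add: orthogonal_transformation_isometry)
qed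

lemma similarity_ball:
  fixes f :: "'a::euclidean_space \<Rightarrow> 'a"
  assumes f: "similarity \<rho> f"
  shows "f ` ball x c = ball (f x) (\<rho> * c)"
proof -
  note \<rho> = similarityD(1)[OF f]
  have "\<exists>z. y = f z" for y
  proof -
    obtain z where z: "(y - f 0) /\<^sub>R \<rho> = (f z - f 0) /\<^sub>R \<rho>"
      using orthogonal_transformation_surj[OF similarity_orthogonal[OF f], THEN surjD, of "(y - f 0) /\<^sub>R \<rho>"] by (rule exE)
    have "\<rho> *\<^sub>R ((y - f 0) /\<^sub>R \<rho>) = \<rho> *\<^sub>R ((f z - f 0) /\<^sub>R \<rho>)" by (rule arg_cong[OF z])
    then have "y = f z" using \<rho> by simp
    then show ?thesis by (rule exI)
  qed
  then have "surj f" unfolding surj_def by (rule allI)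
  show ?thesis
  proof (intro equalityI subsetI)
    fix y assume y: "y \<in> ball (f x) (\<rho> * c)"
    obtain z where z: "y = f z" using surjD[OF \<open>surj f\<close>, of y] by (rule exE)
    then have "dist x z < c" using y \<rho> similarityD(2)[OF f, of x z] by simp
    then show "y \<in> f ` ball x c" unfolding z by (intro imageI) simp
  next
    fix y assume "y \<in> f ` ball x c"
    then obtain z where "y = f z" "dist x z < c" by auto
    then show "y \<in> ball (f x) (\<rho> * c)" using \<rho> similarityD(2)[OF f, of x z] by simp
  qed
qed

text \<open>The images of 0 and of the basis vectors determine a similarity; these are the finitely
  many parameters that get discretised in \<open>ss_class_net\<close>.\<close>

lemma similarity_affine:
  fixes f :: "'a::euclidean_space \<Rightarrow> 'a"
  assumes f: "similarity \<rho> f"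
  shows "f x = f 0 + (\<Sum>b\<in>Basis. (x \<bullet> b) *\<^sub>R (f b - f 0))"
proof -
  have lin: "linear (\<lambda>x. (f x - f 0) /\<^sub>R \<rho>)"
    using orthogonal_transformation_linear[OF similarity_orthogonal[OF f]] .
  have "(f x - f 0) /\<^sub>R \<rho> = (\<lambda>x. (f x - f 0) /\<^sub>R \<rho>) (\<Sum>b\<in>Basis. (x \<bullet> b) *\<^sub>R b)"
    by (simp add: euclidean_representation)
  also have "\<dots> = (\<Sum>b\<in>Basis. (x \<bullet> b) *\<^sub>R ((f b - f 0) /\<^sub>R \<rho>))"
    by (simp only: linear_sum[OF lin] linear_cmul[OF lin])
  also have "\<dots> = (\<Sum>b\<in>Basis. (x \<bullet> b) *\<^sub>R (f b - f 0)) /\<^sub>R \<rho>"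
    unfolding scaleR_sum_right by (simp add: mult.commute)
  finally show ?thesis using similarityD(1)[OF f] by (simp add: diff_eq_eq add.commute)
qed

lemma similarity_dist_le:
  fixes f g :: "'a::euclidean_space \<Rightarrow> 'a"
  assumes f: "similarity \<rho> f" and g: "similarity \<sigma> g"
    and close: "\<And>e. e \<in> insert 0 Basis \<Longrightarrow> dist (f e) (g e) \<le> \<eta>"
  shows "dist (f x) (g x) \<le> (1 + 2 * real DIM('a) * norm x) * \<eta>"
proof -
  have "f x - g x = (f 0 - g 0) + (\<Sum>b\<in>Basis. (x \<bullet> b) *\<^sub>R ((f b - g b) - (f 0 - g 0)))"
  proof -
    have "f x - g x = (f 0 + (\<Sum>b\<in>Basis. (x \<bullet> b) *\<^sub>R (f b - f 0)))
        - (g 0 + (\<Sum>b\<in>Basis. (x \<bullet> b) *\<^sub>R (g b - g 0)))"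
      using similarity_affine[OF f, of x] similarity_affine[OF g, of x] by argo
    also have "\<dots> = (f 0 - g 0) + (\<Sum>b\<in>Basis. (x \<bullet> b) *\<^sub>R (f b - f 0) - (x \<bullet> b) *\<^sub>R (g b - g 0))"
      by (simp add: sum_subtractf)
    also have "(\<Sum>b\<in>Basis. (x \<bullet> b) *\<^sub>R (f b - f 0) - (x \<bullet> b) *\<^sub>R (g b - g 0))
        = (\<Sum>b\<in>Basis. (x \<bullet> b) *\<^sub>R ((f b - g b) - (f 0 - g 0)))"
      by (intro sum.cong refl) (simp add: scaleR_diff_right)
    finally show ?thesis .
  qed
  also have "norm \<dots> \<le> norm (f 0 - g 0) + norm (\<Sum>b\<in>Basis. (x \<bullet> b) *\<^sub>R ((f b - g b) - (f 0 - g 0)))"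
    by (rule norm_triangle_ineq)
  \<comment> \<open>The translation part costs \<eta>; each column \<open>f b - f 0\<close>, being a
    difference of two approximated values, costs 2 \<eta>.\<close>
  also have "\<dots> \<le> \<eta> + (\<Sum>b\<in>(Basis::'a set). norm x * (2 * \<eta>))"
  proof (intro add_mono order.trans[OF norm_sum] sum_mono)
    show "norm (f 0 - g 0) \<le> \<eta>" using close[of 0] by (simp add: dist_norm)
    fix b :: 'a assume b: "b \<in> Basis"
    have "norm ((f b - g b) - (f 0 - g 0)) \<le> 2 * \<eta>"
      using norm_triangle_ineq4[of "f b - g b" "f 0 - g 0"] close[of 0] close[of b] b
      by (simp add: dist_norm)
    then show "norm ((x \<bullet> b) *\<^sub>R ((f b - g b) - (f 0 - g 0))) \<le> norm x * (2 * \<eta>)"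
      unfolding norm_scaleR using Basis_le_norm[OF b, of x]
      by (intro mult_mono) auto
  qed
  finally show ?thesis by (simp add: dist_norm algebra_simps)
qed

section \<open>Moran cut sets of a self-similar set\<close>

locale similarity_ifs =
  fixes f :: "nat \<Rightarrow> 'a::euclidean_space \<Rightarrow> 'a" and \<rho> :: "nat \<Rightarrow> real" and m :: nat and E :: "'a set"
  assumes m_pos: "0 < m"
    and ratio: "\<And>i. i < m \<Longrightarrow> 0 < \<rho> i \<and> \<rho> i < 1"
    and sim: "\<And>i x y. i < m \<Longrightarrow> dist (f i x) (f i y) = \<rho> i * dist x y"
    and compact_E: "compact E" and nonempty_E: "E \<noteq> {}"
    and attractor: "E = (\<Union>i<m. f i ` E)"
begin

primrec word_map :: "nat list \<Rightarrow> 'a \<Rightarrow> 'a" where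
  "word_map [] x = x"
| "word_map (i # w) x = f i (word_map w x)"

primrec word_ratio :: "nat list \<Rightarrow> real" where
  "word_ratio [] = 1"
| "word_ratio (i # w) = \<rho> i * word_ratio w"

text \<open>Finite maximal antichains of the m-ary tree of words. Building them from the first
  letter makes the covering, mass and disjointness properties direct inductions that peel off the
  outermost map.\<close>

inductive cut_set :: "nat list set \<Rightarrow> bool" where
  root: "cut_set {[]}"
| split: "(\<And>i. i < m \<Longrightarrow> cut_set (T i)) \<Longrightarrow> cut_set (\<Union>i<m. (#) i ` T i)"

lemma cut_finite: "cut_set T \<Longrightarrow> finite T"
  by (induction rule: cut_set.induct) auto

lemma cut_letters: "cut_set T \<Longrightarrow> w \<in> T \<Longrightarrow> set w \<subseteq> {..<m}"
  by (induction arbitrary: w rule: cut_set.induct) fastforce+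

lemma word_ratio_pos: "set w \<subseteq> {..<m} \<Longrightarrow> 0 < word_ratio w"
  using ratio by (induction w) auto

lemma word_sim:
  "set w \<subseteq> {..<m} \<Longrightarrow> dist (word_map w x) (word_map w y) = word_ratio w * dist x y"
  using sim by (induction w) auto

lemma word_map_in: "set w \<subseteq> {..<m} \<Longrightarrow> x \<in> E \<Longrightarrow> word_map w x \<in> E"
proof (induction w)
  case (Cons i w)
  then have "f i (word_map w x) \<in> (\<Union>i<m. f i ` E)" by auto
  then show ?case by (subst attractor) simp
qed simp

lemma cut_cover: "cut_set T \<Longrightarrow> E \<subseteq> (\<Union>w\<in>T. word_map w ` E)"
proof (induction rule: cut_set.induct)
  case (split T)
  show ?case
  proof
    fix x assume "x \<in> E"
    then obtain i y where i: "i < m" and y: "y \<in> E" "x = f i y" using attractor by blast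
    then obtain w z where "w \<in> T i" "z \<in> E" "y = word_map w z" using split.IH[OF i] by auto
    then have "i # w \<in> (\<Union>i<m. (#) i ` T i)" "x = word_map (i # w) z" "z \<in> E"
      using i y by auto
    then show "x \<in> (\<Union>w\<in>\<Union>i<m. (#) i ` T i. word_map w ` E)" by blast
  qed
qed simp

text \<open>With \<open>s\<close> the Moran exponent, \<open>word_ratio w powr s\<close> is the mass
  of the cylinder of \<open>w\<close> under the natural Bernoulli weights; splitting a word
  conserves mass.\<close>

lemma cut_sum:
  assumes "cut_set T" and one: "(\<Sum>i<m. \<rho> i powr s) = 1"
  shows "(\<Sum>w\<in>T. word_ratio w powr s) = 1"
  using assms(1)
proof (induction rule: cut_set.induct)
  case (split T)
  have "(\<Sum>w\<in>(\<Union>i<m. (#) i ` T i). word_ratio w powr s)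
      = (\<Sum>i<m. \<Sum>w\<in>(#) i ` T i. word_ratio w powr s)"
    using split.hyps by (intro sum.UNION_disjoint) (auto intro: cut_finite)
  also have "\<dots> = (\<Sum>i<m. \<rho> i powr s * (\<Sum>w\<in>T i. word_ratio w powr s))"
  proof (rule sum.cong[OF refl])
    fix i assume "i \<in> {..<m}"
    then have i: "i < m" by simp
    have "(\<Sum>w\<in>(#) i ` T i. word_ratio w powr s) = (\<Sum>w\<in>T i. word_ratio (i # w) powr s)"
      by (subst sum.reindex) (auto simp: inj_on_def)
    also have "\<dots> = (\<Sum>w\<in>T i. \<rho> i powr s * word_ratio w powr s)"
      using ratio[OF i] word_ratio_pos[OF cut_letters[OF split.hyps[OF i]]]
      by (intro sum.cong refl) (simp add: powr_mult less_imp_le)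
    finally show "(\<Sum>w\<in>(#) i ` T i. word_ratio w powr s)
        = \<rho> i powr s * (\<Sum>w\<in>T i. word_ratio w powr s)" by (simp add: sum_distrib_left)
  qed
  also have "\<dots> = 1" using split.IH one by simp
  finally show ?case .
qed simp

text \<open>Words with the same first letter reduce to their tails by injectivity of
  \<open>f i\<close>; words with different first letters end up in disjoint first-level images of
  \<open>V\<close>.\<close>

lemma cut_disjoint:
  assumes V: "\<And>i. i < m \<Longrightarrow> f i ` V \<subseteq> V"
    and disj: "\<And>i j. i < m \<Longrightarrow> j < m \<Longrightarrow> i \<noteq> j \<Longrightarrow> f i ` V \<inter> f j ` V = {}"
    and "cut_set T" "w \<in> T" "w' \<in> T" "w \<noteq> w'"
  shows "word_map w ` V \<inter> word_map w' ` V = {}"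
proof -
  have sub: "word_map u ` V \<subseteq> V" if "set u \<subseteq> {..<m}" for u
    using that V by (induction u) (auto simp: image_subset_iff)
  have inj: "f i x = f i y \<longleftrightarrow> x = y" if "i < m" for i x y
    using sim[OF that, of x y] ratio[OF that] by (metis dist_eq_0_iff mult_eq_0_iff less_irrefl)
  from assms(3-) show ?thesis
  proof (induction arbitrary: w w' rule: cut_set.induct)
    case (split T)
    obtain i u where i: "i < m" "u \<in> T i" "w = i # u" using split.prems by auto
    obtain j u' where j: "j < m" "u' \<in> T j" "w' = j # u'" using split.prems by auto
    show ?case
    proof (cases "i = j")
      case True
      then have "word_map u ` V \<inter> word_map u' ` V = {}" using split.IH i j split.prems by auto
      then show ?thesis using i j True inj by auto
    next
      case False
      have "word_map w ` V \<subseteq> f i ` V" "word_map w' ` V \<subseteq> f j ` V"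
        using i j sub[OF cut_letters[OF split.hyps]] by fastforce+
      then show ?thesis using disj[OF i(1) j(1) False] by blast
    qed
  qed simp
qed

definition "ratio_min = Min (\<rho> ` {..<m})"
definition "ratio_max = Max (\<rho> ` {..<m})"

lemma ratio_bounds:
  shows "0 < ratio_min" "ratio_max < 1" "\<And>i. i < m \<Longrightarrow> ratio_min \<le> \<rho> i \<and> \<rho> i \<le> ratio_max" "ratio_min < 1"
proof -
  have ne: "finite (\<rho> ` {..<m})" "\<rho> ` {..<m} \<noteq> {}" using m_pos by auto
  show "0 < ratio_min" "ratio_max < 1" unfolding ratio_min_def ratio_max_def
    using ratio ne by auto
  show b: "\<And>i. i < m \<Longrightarrow> ratio_min \<le> \<rho> i \<and> \<rho> i \<le> ratio_max"
    unfolding ratio_min_def ratio_max_def using ne by auto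
  show "ratio_min < 1" using b[OF m_pos] ratio[OF m_pos] by linarith
qed

text \<open>Read letters until the ratio is at most \<delta>; the last letter costs no more than a
  factor \<open>ratio_min\<close>.\<close>

lemma cut_exists:
  assumes "0 < \<delta>" "\<delta> \<le> 1"
  shows "\<exists>T. cut_set T \<and> (\<forall>w\<in>T. ratio_min * \<delta> \<le> word_ratio w \<and> word_ratio w \<le> \<delta>)"
proof -
  \<comment> \<open>The induction is on a bound \<open>k\<close> for the depth: after the letter
    \<open>i\<close> the remaining scale is \<delta> / \<open>\<rho> i\<close>, which is at least
    \<open>ratio_max\<close> to one power fewer.\<close>
  have *: "\<exists>T. cut_set T \<and> (\<forall>w\<in>T. ratio_min * \<delta> \<le> word_ratio w \<and> word_ratio w \<le> \<delta>)"
    if "ratio_max ^ k \<le> \<delta>" "0 < \<delta>" "\<delta> \<le> 1" for k \<delta>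
    using that
  proof (induction k arbitrary: \<delta>)
    case 0
    then have "\<delta> = 1" by simp
    then show ?case using root ratio_bounds by (intro exI[of _ "{[]}"]) auto
  next
    case (Suc k)
    have "\<exists>T. cut_set T \<and> (\<forall>w\<in>T. ratio_min * \<delta> \<le> \<rho> i * word_ratio w \<and> \<rho> i * word_ratio w \<le> \<delta>)"
      if i: "i < m" for i
    proof (cases "\<rho> i \<le> \<delta>")
      case True
      have "ratio_min * \<delta> \<le> ratio_min * 1"
        using Suc.prems ratio_bounds by (intro mult_left_mono) auto
      then show ?thesis using root True ratio_bounds(3)[OF i] by (intro exI[of _ "{[]}"]) auto
    next
      case False
      have r: "0 < \<rho> i" using ratio i by blast
      have "\<rho> i * ratio_max ^ k \<le> ratio_max ^ Suc k"
        using ratio_bounds(3)[OF i] r by (simp add: mult_right_mono)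
      then have "ratio_max ^ k \<le> \<delta> / \<rho> i" using Suc.prems r by (simp add: field_simps)
      then obtain T where "cut_set T" "\<forall>w\<in>T. ratio_min * (\<delta> / \<rho> i) \<le> word_ratio w \<and> word_ratio w \<le> \<delta> / \<rho> i"
        using Suc.IH[of "\<delta> / \<rho> i"] False r Suc.prems by auto
      then show ?thesis using r by (intro exI[of _ T]) (auto simp: field_simps)
    qed
    then obtain T where T: "\<And>i. i < m \<Longrightarrow> cut_set (T i) \<and>
       (\<forall>w\<in>T i. ratio_min * \<delta> \<le> \<rho> i * word_ratio w \<and> \<rho> i * word_ratio w \<le> \<delta>)" by metis
    then show ?case by (intro exI[of _ "\<Union>i<m. (#) i ` T i"] conjI split) auto
  qed
  obtain k where "ratio_max ^ k < \<delta>"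
    using real_arch_pow_inv[OF assms(1) ratio_bounds(2)] by auto
  then show ?thesis using *[of k \<delta>] assms by auto
qed

text \<open>Intermediate value theorem: the sum is \<open>m >= 1\<close> at exponent 0 and at most
  \<open>m * ratio_max ^ n < 1\<close> at a large integer \<open>n\<close>.\<close>

lemma moran_exponent: "\<exists>s\<ge>0. (\<Sum>i<m. \<rho> i powr s) = 1"
proof -
  let ?g = "\<lambda>s. \<Sum>i<m. \<rho> i powr s"
  have nz: "\<rho> i \<noteq> 0" if "i < m" for i using ratio[OF that] by simp
  have "ratio_max > 0" using ratio_bounds(3)[OF m_pos] ratio[OF m_pos] by linarith
  have "(\<lambda>n. real m * ratio_max ^ n) \<longlonglongrightarrow> real m * 0"
    using ratio_bounds \<open>ratio_max > 0\<close> by (intro tendsto_intros LIMSEQ_power_zero) auto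
  then have "\<forall>\<^sub>F n in sequentially. real m * ratio_max ^ n < 1"
    by (intro order_tendstoD(2)) auto
  then obtain n where n: "real m * ratio_max ^ n < 1" by (meson eventually_sequentially order_refl)
  have "?g (real n) \<le> (\<Sum>i<m. ratio_max ^ n)"
    using ratio ratio_bounds by (intro sum_mono) (simp add: powr_realpow power_mono less_imp_le)
  then have "?g (real n) \<le> 1" using n by simp
  moreover have "1 \<le> ?g 0"
  proof -
    have "?g 0 = (\<Sum>i<m. 1)" using nz by (intro sum.cong) auto
    then show ?thesis using m_pos by simp
  qed
  moreover have "continuous_on {0..real n} ?g"
    using nz by (intro continuous_intros) auto
  ultimately obtain s where "0 \<le> s" "?g s = 1"
    using IVT2'[of ?g "real n" 1 0] of_nat_0_le_iff by blast
  then show ?thesis by (intro exI[of _ s]) simp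
qed

end

definition assouad_bound :: "real \<Rightarrow> real \<Rightarrow> 'a::metric_space set \<Rightarrow> bool" where
  "assouad_bound C s E \<longleftrightarrow> (\<forall>x \<rho> \<delta>. 0 < \<delta> \<longrightarrow> \<delta> \<le> \<rho> \<longrightarrow>
     (\<exists>Q. finite Q \<and> real (card Q) \<le> C * (\<rho> / \<delta>) powr s \<and> E \<inter> ball x \<rho> \<subseteq> (\<Union>y\<in>Q. ball y \<delta>)))"

lemma assouad_boundD:
  assumes "assouad_bound C s E" "0 < \<delta>" "\<delta> \<le> \<rho>"
  shows "\<exists>Q. finite Q \<and> real (card Q) \<le> C * (\<rho> / \<delta>) powr s \<and> E \<inter> ball x \<rho> \<subseteq> (\<Union>y\<in>Q. ball y \<delta>)"
  by (rule assms(1)[unfolded assouad_bound_def, rule_format, OF assms(2,3)])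

lemma assouad_bound_mono:
  assumes "assouad_bound C s E" "C \<le> C'" "s \<le> s'" "0 \<le> C"
  shows "assouad_bound C' s' E"
  unfolding assouad_bound_def
proof (intro allI impI)
  fix x and \<rho> \<delta> :: real assume d: "0 < \<delta>" "\<delta> \<le> \<rho>"
  from assouad_boundD[OF assms(1) d, of x] obtain Q where Q: "finite Q" "real (card Q) \<le> C * (\<rho> / \<delta>) powr s"
    "E \<inter> ball x \<rho> \<subseteq> (\<Union>y\<in>Q. ball y \<delta>)" by (elim exE conjE)
  have "C * (\<rho> / \<delta>) powr s \<le> C' * (\<rho> / \<delta>) powr s'"
    using assms d by (intro mult_mono powr_mono) auto
  then show "\<exists>Q. finite Q \<and> real (card Q) \<le> C' * (\<rho> / \<delta>) powr s' \<and> E \<inter> ball x \<rho> \<subseteq> (\<Union>y\<in>Q. ball y \<delta>)"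
    using Q by (intro exI[of _ Q]) auto
qed

text \<open>Volume comparison: shrinking all balls to radius \<open>a\<close> leaves disjoint balls
  of equal volume inside \<open>ball x b\<close>.\<close>

lemma card_disjoint_balls_le:
  fixes p :: "'i \<Rightarrow> 'a::euclidean_space"
  assumes "finite S" "0 < a" and a: "\<And>u. u \<in> S \<Longrightarrow> a \<le> r u"
    and disj: "\<And>u u'. u \<in> S \<Longrightarrow> u' \<in> S \<Longrightarrow> u \<noteq> u' \<Longrightarrow> ball (p u) (r u) \<inter> ball (p u') (r u') = {}"
    and sub: "\<And>u. u \<in> S \<Longrightarrow> ball (p u) (r u) \<subseteq> ball x b" and "0 \<le> b"
  shows "real (card S) \<le> (b / a) ^ DIM('a)"
proof -
  let ?vol = "measure (lborel :: 'a measure)"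
  have fm: "ball y t \<in> fmeasurable lborel" for y :: 'a and t
    using emeasure_lborel_ball_finite[of y t] by (intro fmeasurableI) auto
  have c: "?vol (ball y t) = unit_ball_vol (real DIM('a)) * t ^ DIM('a)" if "0 \<le> t" for y :: 'a and t
    using content_ball[OF that] .
  have "real (card S) * (unit_ball_vol (real DIM('a)) * a ^ DIM('a)) = (\<Sum>u\<in>S. ?vol (ball (p u) a))"
    using c assms(2) by simp
  also have "\<dots> \<le> (\<Sum>u\<in>S. ?vol (ball (p u) (r u)))"
    using fm by (intro sum_mono measure_mono_fmeasurable subset_ball a) auto
  also have "\<dots> = ?vol (\<Union>u\<in>S. ball (p u) (r u))"
    using disj fm assms(1) by (intro measure_UNION'[symmetric]) (auto simp: pairwise_def disjnt_def)
  also have "\<dots> \<le> ?vol (ball x b)"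
    using sub fm assms(1) by (intro measure_mono_fmeasurable) auto
  also have "\<dots> = unit_ball_vol (real DIM('a)) * b ^ DIM('a)" using c assms by simp
  finally have "real (card S) * a ^ DIM('a) \<le> b ^ DIM('a)"
    by (simp add: mult.left_commute)
  then show ?thesis using assms(2) by (simp add: power_divide pos_le_divide_eq)
qed

section \<open>Open set condition: bounded overlap, Assouad bound, Moran exponent versus Hausdorff
  dimension\<close>

locale osc_ifs = similarity_ifs +
  fixes V :: "'a set"
  assumes open_V: "open V" and V_ne: "V \<noteq> {}"
    and V_sub: "\<And>i. i < m \<Longrightarrow> f i ` V \<subseteq> V"
    and V_disj: "\<And>i j. i < m \<Longrightarrow> j < m \<Longrightarrow> i \<noteq> j \<Longrightarrow> f i ` V \<inter> f j ` V = {}"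
begin

definition scaled_cut :: "real \<Rightarrow> nat list set \<Rightarrow> bool" where
  "scaled_cut t T \<longleftrightarrow> 0 < t \<and> cut_set T \<and> (\<forall>u\<in>T. ratio_min * t \<le> word_ratio u \<and> word_ratio u \<le> t)"

lemma scaled_cut_exists: "0 < t \<Longrightarrow> t \<le> 1 \<Longrightarrow> \<exists>T. scaled_cut t T"
  unfolding scaled_cut_def using cut_exists by simp

text \<open>Here the open set condition becomes counting. A ball in \<open>V\<close> has disjoint
  images under the words of a cut; at scale \<open>t\<close> their radii are at least a constant
  times \<open>t\<close>, and those whose piece meets \<open>ball x t\<close> lie in a ball of
  radius proportional to \<open>t\<close>. The volume quotient is free of \<open>t\<close>,
  \<open>x\<close> and \<open>T\<close>.\<close>

lemma cut_overlap:
  "\<exists>q. \<forall>T t x. scaled_cut t T \<longrightarrow> real (card {u\<in>T. word_map u ` E \<inter> ball x t \<noteq> {}}) \<le> q"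
proof -
  obtain v where "v \<in> V" using V_ne by blast
  then obtain c where c: "0 < c" "ball v c \<subseteq> V" using open_V open_contains_ball by blast
  obtain D where D: "\<And>e. e \<in> E \<Longrightarrow> dist v e \<le> D"
    using compact_imp_bounded[OF compact_E] bounded_any_center[of E v] by blast
  obtain e1 where "e1 \<in> E" using nonempty_E by blast
  then have D0: "0 \<le> D" using D[of e1] zero_le_dist[of v e1] by linarith
  \<comment> \<open>\<open>1 + D + c\<close> adds up the way from \<open>x\<close> to the piece,
    from there to the image of \<open>v\<close> (\<open>D\<close> bounds the distance of
    \<open>v\<close> from points of \<open>E\<close>), and across the image of
    \<open>ball v c\<close>, each in units of \<open>t\<close>.\<close>
  have bound: "real (card {u\<in>T. word_map u ` E \<inter> ball x t \<noteq> {}}) \<le> (((1 + D + c) * t) / (ratio_min * t * c)) ^ DIM('a)"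
    if T: "cut_set T" and t: "0 < t" and R: "\<And>u. u \<in> T \<Longrightarrow> ratio_min * t \<le> word_ratio u \<and> word_ratio u \<le> t" for T t x
  proof -
    have ball: "word_map u ` ball v c = ball (word_map u v) (word_ratio u * c)" if "u \<in> T" for u
      using word_sim[OF cut_letters[OF T that]] word_ratio_pos[OF cut_letters[OF T that]]
      by (intro similarity_ball) (auto simp: similarity_def)
    show ?thesis
    proof (rule card_disjoint_balls_le[where p = "\<lambda>u. word_map u v" and r = "\<lambda>u. word_ratio u * c" and x = x])
      show "finite {u\<in>T. word_map u ` E \<inter> ball x t \<noteq> {}}" using cut_finite[OF T] by simp
      show "0 < ratio_min * t * c" using c t ratio_bounds by simp
      show "0 \<le> (1 + D + c) * t" using D0 c t by simp
      fix u assume "u \<in> {u\<in>T. word_map u ` E \<inter> ball x t \<noteq> {}}"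
      then obtain e where u: "u \<in> T" "e \<in> E" "dist x (word_map u e) < t" by auto
      show "ratio_min * t * c \<le> word_ratio u * c" using R[OF u(1)] c by simp
      have "dist x y < (1 + D + c) * t" if "dist (word_map u v) y < word_ratio u * c" for y
      proof -
        have "dist (word_map u e) (word_map u v) = word_ratio u * dist v e"
          using word_sim[OF cut_letters[OF T u(1)]] by (simp add: dist_commute)
        also have "\<dots> \<le> t * D" using D[OF u(2)] R[OF u(1)] t by (intro mult_mono) auto
        finally have "dist (word_map u e) (word_map u v) \<le> t * D" .
        moreover have "word_ratio u * c \<le> t * c" using R[OF u(1)] c by simp
        moreover have "dist x y \<le> dist x (word_map u e) + (dist (word_map u e) (word_map u v) + dist (word_map u v) y)"
          using dist_triangle[of x y "word_map u e"] dist_triangle[of "word_map u e" y "word_map u v"] by linarith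
        moreover have "(1 + D + c) * t = t + t * D + t * c" by (simp add: algebra_simps)
        ultimately show ?thesis using u(3) that by linarith
      qed
      then show "ball (word_map u v) (word_ratio u * c) \<subseteq> ball x ((1 + D + c) * t)" by auto
    next
      fix u u' assume u: "u \<in> {u\<in>T. word_map u ` E \<inter> ball x t \<noteq> {}}" "u' \<in> {u\<in>T. word_map u ` E \<inter> ball x t \<noteq> {}}" "u \<noteq> u'"
      then have uT: "u \<in> T" "u' \<in> T" by auto
      have "word_map u ` V \<inter> word_map u' ` V = {}"
        using cut_disjoint[OF V_sub V_disj T uT u(3)] by blast
      then show "ball (word_map u v) (word_ratio u * c) \<inter> ball (word_map u' v) (word_ratio u' * c) = {}"
        unfolding ball[OF uT(1), symmetric] ball[OF uT(2), symmetric] using image_mono[OF c(2)]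
        by (meson disjoint_iff subset_iff)
    qed
  qed
  have eq: "((1 + D + c) * t) / (ratio_min * t * c) = (1 + D + c) / (ratio_min * c)" if "0 < t" for t
    using that by simp
  show ?thesis
  proof (intro exI[of _ "((1 + D + c) / (ratio_min * c)) ^ DIM('a)"] allI impI)
    fix T t x assume "scaled_cut t T"
    then have T: "cut_set T" and t: "0 < t"
      and R: "\<forall>u\<in>T. ratio_min * t \<le> word_ratio u \<and> word_ratio u \<le> t"
      unfolding scaled_cut_def by auto
    show "real (card {u\<in>T. word_map u ` E \<inter> ball x t \<noteq> {}}) \<le> ((1 + D + c) / (ratio_min * c)) ^ DIM('a)"
      using bound[OF T t, of x] R unfolding eq[OF t] by simp
  qed
qed

text \<open>Every word carries mass at least \<open>t powr s\<close>, and the total mass is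
  1.\<close>

lemma card_cut_le:
  assumes "cut_set T" "0 < t" "\<And>u. u \<in> T \<Longrightarrow> t \<le> word_ratio u"
    and s: "0 \<le> s" "(\<Sum>i<m. \<rho> i powr s) = 1"
  shows "real (card T) \<le> (1 / t) powr s"
proof -
  have "real (card T) * t powr s = (\<Sum>u\<in>T. t powr s)" by simp
  also have "\<dots> \<le> (\<Sum>u\<in>T. word_ratio u powr s)"
    using assms by (intro sum_mono powr_mono2) auto
  also have "\<dots> = 1" by (rule cut_sum[OF assms(1) s(2)])
  finally show ?thesis using assms(2) by (simp add: powr_divide field_simps)
qed

text \<open>A cut in two stages: boundedly many pieces of scale \<open>r\<close> meet the ball, and
  all of them are subdivided by the same cut \<open>T'\<close> of relative scale about \<delta> /
  \<open>r\<close>, whose size is controlled by the Moran equation.\<close>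

lemma attractor_assouad:
  assumes s: "0 \<le> s" "(\<Sum>i<m. \<rho> i powr s) = 1"
  shows "\<exists>C\<ge>0. assouad_bound C s E"
proof -
  obtain q where "\<forall>T t x. scaled_cut t T \<longrightarrow> real (card {u\<in>T. word_map u ` E \<inter> ball x t \<noteq> {}}) \<le> q"
    using cut_overlap by (rule exE)
  note q = this[rule_format]
  obtain e0 where e0: "e0 \<in> E" using nonempty_E by blast
  define K where "K = diameter E + 1"
  have bE: "bounded E" using compact_imp_bounded[OF compact_E] .
  have K: "1 \<le> K" using diameter_ge_0[OF bE] K_def by simp
  define C where "C = max q 1 * (K / ratio_min) powr s"
  have "0 \<le> C" using C_def by simp
  moreover have "\<exists>Q. finite Q \<and> real (card Q) \<le> C * (r / \<delta>) powr s \<and> E \<inter> ball x r \<subseteq> (\<Union>y\<in>Q. ball y \<delta>)"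
    if d: "0 < \<delta>" "\<delta> \<le> r" for x r \<delta>
  proof -
    \<comment> \<open>A word of the first cut followed by one of \<open>T'\<close> has ratio at most
      \<open>r * t = \<delta> / K\<close>. Since \<open>K = diameter E + 1\<close>, its piece has
      diameter strictly below \<delta>, as open balls require; \<open>1 <= K\<close> also gives
      \<open>t <= 1\<close>.\<close>
    define t where "t = \<delta> / (r * K)"
    have "\<delta> \<le> r * K" using mult_mono[OF d(2) K] d by simp
    then have t: "0 < t" "t \<le> 1" using d K by (auto simp: t_def)
    obtain T' where T': "cut_set T'" "\<And>w. w \<in> T' \<Longrightarrow> ratio_min * t \<le> word_ratio w \<and> word_ratio w \<le> t"
      using cut_exists[OF t] by blast
    have "\<exists>T. cut_set T \<and> (\<forall>u\<in>T. word_ratio u \<le> r) \<and> real (card {u\<in>T. word_map u ` E \<inter> ball x r \<noteq> {}}) \<le> max q 1"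
    proof (cases "r \<le> 1")
      case True
      obtain T where "scaled_cut r T" using scaled_cut_exists[of r] True d by auto
      then show ?thesis using q[of r T x] by (intro exI[of _ T]) (auto simp: scaled_cut_def)
    next
      \<comment> \<open>\<open>cut_exists\<close> yields cuts only for scales up to 1. For larger
        \<open>r\<close> the trivial cut serves: its one word has ratio 1, and its count is the
        reason for \<open>max q 1\<close>.\<close>
      case False
      have "card {u\<in>{[]}. word_map u ` E \<inter> ball x r \<noteq> {}} \<le> card {[]::nat list}" by (intro card_mono) auto
      then show ?thesis using False root by (intro exI[of _ "{[]}"]) (auto simp: le_max_iff_disj)
    qed
    then obtain T where T: "cut_set T" "\<And>u. u \<in> T \<Longrightarrow> word_ratio u \<le> r"
      and cS: "real (card {u\<in>T. word_map u ` E \<inter> ball x r \<noteq> {}}) \<le> max q 1" by blast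
    define S where "S = {u\<in>T. word_map u ` E \<inter> ball x r \<noteq> {}}"
    define Q where "Q = (\<lambda>(u, w). word_map u (word_map w e0)) ` (S \<times> T')"
    have fin: "finite S" "finite T'" using cut_finite[OF T(1)] cut_finite[OF T'(1)] S_def by auto
    have "card Q \<le> card S * card T'"
      using card_image_le[of "S \<times> T'"] fin by (simp add: Q_def card_cartesian_product)
    then have "real (card Q) \<le> real (card S) * real (card T')"
      by (metis of_nat_le_iff of_nat_mult)
    also have "\<dots> \<le> max q 1 * (1 / (ratio_min * t)) powr s"
      using cS S_def T' s t ratio_bounds
      by (intro mult_mono card_cut_le) auto
    also have "1 / (ratio_min * t) = (K / ratio_min) * (r / \<delta>)"
      using d K by (simp add: t_def)
    also have "max q 1 * \<dots> powr s = C * (r / \<delta>) powr s"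
      using d K ratio_bounds by (subst powr_mult) (auto simp: C_def)
    finally have card: "real (card Q) \<le> C * (r / \<delta>) powr s" .
    have "z \<in> (\<Union>y\<in>Q. ball y \<delta>)" if z: "z \<in> E" "dist x z < r" for z
    proof -
      obtain u z' where u: "u \<in> T" "z' \<in> E" "z = word_map u z'" using cut_cover[OF T(1)] z(1) by blast
      obtain w z'' where w: "w \<in> T'" "z'' \<in> E" "z' = word_map w z''" using cut_cover[OF T'(1)] u(2) by blast
      have "u \<in> S" using u z S_def by auto
      then have yQ: "word_map u (word_map w e0) \<in> Q" using w(1) Q_def by force
      have lu: "set u \<subseteq> {..<m}" "set w \<subseteq> {..<m}" using cut_letters T(1) T'(1) u(1) w(1) by auto
      have "dist (word_map u (word_map w e0)) z = word_ratio u * (word_ratio w * dist e0 z'')"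
        using u(3) w(3) by (simp add: word_sim lu)
      also have "\<dots> \<le> r * (t * diameter E)"
        using T(2)[OF u(1)] T'(2)[OF w(1)] diameter_bounded_bound[OF bE e0 w(2)] word_ratio_pos[OF lu(1)]
          word_ratio_pos[OF lu(2)] t d by (intro mult_mono) auto
      also have "\<dots> = \<delta> * (diameter E / K)" using d by (simp add: t_def)
      also have "\<dots> < \<delta> * 1" using d K by (intro mult_strict_left_mono) (auto simp: K_def)
      finally show ?thesis using yQ by auto
    qed
    then show ?thesis using card fin Q_def by (intro exI[of _ Q]) auto
  qed
  ultimately show ?thesis unfolding assouad_bound_def by blast
qed

text \<open>Counting words in place of measuring: times \<open>\<delta> powr s\<close> and up to
  constants, the left side is the natural mass of \<open>ball x r\<close>, so this is the Frostman
  bound for the mass distribution argument. Words are counted, not points, so coinciding images do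
  no harm.\<close>

lemma card_cut_ball_le:
  assumes s: "0 \<le> s" "(\<Sum>i<m. \<rho> i powr s) = 1" and e0: "e0 \<in> E"
  shows "\<exists>C>0. \<forall>T \<delta> x r. scaled_cut \<delta> T \<longrightarrow> \<delta> \<le> r \<longrightarrow>
     real (card {w\<in>T. word_map w e0 \<in> ball x r}) \<le> C * (r / \<delta>) powr s"
proof -
  obtain q where "\<forall>T t x. scaled_cut t T \<longrightarrow> real (card {u\<in>T. word_map u ` E \<inter> ball x t \<noteq> {}}) \<le> q"
    using cut_overlap by (rule exE)
  note q = this[rule_format]
  obtain C where C: "0 \<le> C" "assouad_bound C s E" using attractor_assouad[OF s] by blast
  have "real (card {w\<in>T. word_map w e0 \<in> ball x r}) \<le> ((C + 1) * max q 1) * (r / \<delta>) powr s"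
    if sc: "scaled_cut \<delta> T" and dr: "\<delta> \<le> r" for T \<delta> x r
  proof -
    have T: "cut_set T" and d: "0 < \<delta>" "\<delta> \<le> r" using sc dr by (auto simp: scaled_cut_def)
    obtain Q where Q: "finite Q" "real (card Q) \<le> C * (r / \<delta>) powr s" "E \<inter> ball x r \<subseteq> (\<Union>y\<in>Q. ball y \<delta>)"
      using assouad_boundD[OF C(2) d, of x] by (elim exE conjE)
    have "{w\<in>T. word_map w e0 \<in> ball x r} \<subseteq> (\<Union>y\<in>Q. {w\<in>T. word_map w ` E \<inter> ball y \<delta> \<noteq> {}})"
    proof
      fix w assume w: "w \<in> {w\<in>T. word_map w e0 \<in> ball x r}"
      then have "word_map w e0 \<in> E" using word_map_in[OF cut_letters[OF T] e0] by simp
      then obtain y where "y \<in> Q" "word_map w e0 \<in> ball y \<delta>" using Q(3) w by blast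
      then show "w \<in> (\<Union>y\<in>Q. {w\<in>T. word_map w ` E \<inter> ball y \<delta> \<noteq> {}})" using w e0 by blast
    qed
    then have "card {w\<in>T. word_map w e0 \<in> ball x r} \<le> card (\<Union>y\<in>Q. {w\<in>T. word_map w ` E \<inter> ball y \<delta> \<noteq> {}})"
      using Q(1) cut_finite[OF T] by (intro card_mono) auto
    also have "\<dots> \<le> (\<Sum>y\<in>Q. card {w\<in>T. word_map w ` E \<inter> ball y \<delta> \<noteq> {}})"
      by (rule card_UN_le[OF Q(1)])
    finally have "real (card {w\<in>T. word_map w e0 \<in> ball x r}) \<le> (\<Sum>y\<in>Q. real (card {w\<in>T. word_map w ` E \<inter> ball y \<delta> \<noteq> {}}))"
      by (simp flip: of_nat_sum)
    also have "\<dots> \<le> (\<Sum>y\<in>Q. max q 1)" using q[OF sc] by (intro sum_mono) (auto simp: le_max_iff_disj)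
    also have "\<dots> = real (card Q) * max q 1" by simp
    also have "\<dots> \<le> ((C + 1) * (r / \<delta>) powr s) * max q 1"
      using Q(2) by (intro mult_right_mono order.trans[OF Q(2)]) auto
    finally show ?thesis by (simp add: mult_ac)
  qed
  then show ?thesis using C(1) by (intro exI[of _ "(C + 1) * max q 1"]) auto
qed

text \<open>Mass distribution principle by counting. If \<open>s < s0\<close>, a cover that is cheap
  for \<open>s\<close> becomes a finite cover by balls. At a scale \<delta> below all their radii,
  the Frostman bound allows fewer words than the Moran equation forces a cut to have.\<close>

lemma moran_exponent_le:
  assumes s0: "0 \<le> s0" "(\<Sum>i<m. \<rho> i powr s0) = 1"
    and s: "0 < s" "hausdorff_measure s E = 0"
  shows "s0 \<le> s"
proof (rule ccontr)
  assume "\<not> s0 \<le> s"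
  then have ss: "s < s0" by simp
  obtain e0 where e0: "e0 \<in> E" using nonempty_E by blast
  obtain C where C: "0 < C" and "\<forall>T \<delta> x r. scaled_cut \<delta> T \<longrightarrow> \<delta> \<le> r \<longrightarrow>
     real (card {w\<in>T. word_map w e0 \<in> ball x r}) \<le> C * (r / \<delta>) powr s0"
    using card_cut_ball_le[OF s0 e0] by (elim exE conjE)
  note cnt = this(2)[rule_format]
  \<comment> \<open>Two demands: a sum of at most \<open>2 * \<epsilon> <= 1\<close> keeps all radii
    below or equal to 1, so that raising the exponent from \<open>s\<close> to \<open>s0\<close>
    shrinks the sum; \<open>2 * \<epsilon> * C < 1\<close> gives the contradiction.\<close>
  define \<epsilon> where "\<epsilon> = min (1/2) (1 / (4 * C))"
  have \<epsilon>: "0 < \<epsilon>" "2 * \<epsilon> \<le> 1" "2 * \<epsilon> * C < 1" using C by (auto simp: \<epsilon>_def min_def field_simps)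
  have "hausdorff_pre s 1 E \<le> hausdorff_measure s E"
    unfolding hausdorff_measure_def by (rule SUP_upper) simp
  then have "hausdorff_pre s 1 E < ennreal \<epsilon>" using s \<epsilon> by simp
  then obtain U where U: "E \<subseteq> (\<Union>i. U i)" "\<And>i. bounded (U i)"
    and Usum: "(\<Sum>i. ennreal (diameter (U i) powr s)) < ennreal \<epsilon>"
    unfolding hausdorff_pre_def INF_less_iff by auto
  \<comment> \<open>Sets of diameter 0 need a positive radius too. Adding a geometric share of
    \<epsilon> to the s-th power of the diameter makes \<open>d i\<close> exceed the diameter, while
    the s-th powers still sum to at most 2 \<epsilon>.\<close>
  define d where "d i = (diameter (U i) powr s + \<epsilon> * (1/2) ^ Suc i) powr (1 / s)" for i :: nat
  have \<epsilon>i: "0 < \<epsilon> * (1/2) ^ Suc i" for i using \<epsilon> by simp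
  have d_s: "d i powr s = diameter (U i) powr s + \<epsilon> * (1/2) ^ Suc i" for i
  proof -
    have "0 < diameter (U i) powr s + \<epsilon> * (1/2) ^ Suc i" using \<epsilon>i[of i] by (meson add_nonneg_pos powr_ge_zero)
    then show ?thesis using s unfolding d_def by (simp add: powr_powr)
  qed
  have d_pos: "0 < d i" for i
  proof -
    have "0 < d i powr s" unfolding d_s using \<epsilon>i[of i] by (meson add_nonneg_pos powr_ge_zero)
    then show ?thesis unfolding d_def by (metis powr_ge_zero less_le powr_0 d_def s(1) less_irrefl powr_eq_0_iff)
  qed
  have d_diam: "diameter (U i) < d i" for i
  proof (rule ccontr)
    assume "\<not> diameter (U i) < d i"
    then have "d i powr s \<le> diameter (U i) powr s" using d_pos[of i] s by (intro powr_mono2) auto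
    then show False unfolding d_s using \<epsilon>i[of i] by linarith
  qed
  define x where "x i = (SOME y. y \<in> U i)" for i
  have "E \<subseteq> (\<Union>i. ball (x i) (d i))"
  proof
    fix y assume "y \<in> E"
    then obtain i where i: "y \<in> U i" using U(1) by blast
    then have "x i \<in> U i" unfolding x_def by (rule someI)
    then have "dist (x i) y < d i" using diameter_bounded_bound[OF U(2) _ i] d_diam[of i] by fastforce
    then show "y \<in> (\<Union>i. ball (x i) (d i))" by auto
  qed
  then obtain I where I: "finite I" "E \<subseteq> (\<Union>i\<in>I. ball (x i) (d i))"
    using compactE_image[OF compact_E, of UNIV "\<lambda>i. ball (x i) (d i)"] by auto
  have Ine: "I \<noteq> {}" using I(2) e0 by auto
  have sum_s: "(\<Sum>i\<in>I. d i powr s) \<le> \<epsilon> + \<epsilon>"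
  proof -
    have "(\<Sum>i\<in>I. ennreal (diameter (U i) powr s)) \<le> (\<Sum>i. ennreal (diameter (U i) powr s))"
      by (intro sum_le_suminf I(1)) auto
    then have "ennreal (\<Sum>i\<in>I. diameter (U i) powr s) \<le> ennreal \<epsilon>"
      using Usum by (simp add: sum_ennreal)
    then have 1: "(\<Sum>i\<in>I. diameter (U i) powr s) \<le> \<epsilon>"
      using \<epsilon> by (simp add: ennreal_le_iff)
    have "(\<Sum>i\<in>I. (1/2::real) ^ Suc i) \<le> 1"
      using sum_le_suminf[of "\<lambda>i. (1/2::real) ^ Suc i" I] power_half_series I(1) sums_unique[OF power_half_series]
      by (simp add: sums_iff)
    then have "\<epsilon> * (\<Sum>i\<in>I. (1/2::real) ^ Suc i) \<le> \<epsilon> * 1" using \<epsilon> by (intro mult_left_mono) auto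
    then show ?thesis using 1 unfolding d_s sum.distrib sum_distrib_left[symmetric] by linarith
  qed
  have "d i \<le> 1" if "i \<in> I" for i
  proof (rule ccontr)
    assume "\<not> d i \<le> 1"
    then have "1 < d i powr s" using s by (intro gr_one_powr) auto
    also have "\<dots> \<le> (\<Sum>i\<in>I. d i powr s)" using I(1) that by (intro member_le_sum) auto
    finally show False using sum_s \<epsilon> by linarith
  qed
  then have "(\<Sum>i\<in>I. d i powr s0) \<le> (\<Sum>i\<in>I. d i powr s)"
    using d_pos ss by (intro sum_mono powr_mono') (auto simp: less_imp_le)
  then have d_sum: "(\<Sum>i\<in>I. d i powr s0) \<le> 2 * \<epsilon>" using sum_s by linarith
  define \<delta> where "\<delta> = min 1 (Min (d ` I))"
  have \<delta>: "0 < \<delta>" "\<delta> \<le> 1" "\<And>i. i \<in> I \<Longrightarrow> \<delta> \<le> d i"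
    using I(1) Ine d_pos by (auto simp: \<delta>_def min_le_iff_disj)
  obtain T where T: "scaled_cut \<delta> T" using scaled_cut_exists[OF \<delta>(1,2)] by (rule exE)
  have Tc: "cut_set T" and TR: "\<And>u. u \<in> T \<Longrightarrow> word_ratio u \<le> \<delta>" using T by (auto simp: scaled_cut_def)
  have "T \<subseteq> (\<Union>i\<in>I. {w\<in>T. word_map w e0 \<in> ball (x i) (d i)})"
    using word_map_in[OF cut_letters[OF Tc] e0] I(2) by blast
  then have "card T \<le> card (\<Union>i\<in>I. {w\<in>T. word_map w e0 \<in> ball (x i) (d i)})"
    using I(1) cut_finite[OF Tc] by (intro card_mono) auto
  also have "\<dots> \<le> (\<Sum>i\<in>I. card {w\<in>T. word_map w e0 \<in> ball (x i) (d i)})"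
    by (rule card_UN_le[OF I(1)])
  finally have "real (card T) \<le> (\<Sum>i\<in>I. real (card {w\<in>T. word_map w e0 \<in> ball (x i) (d i)}))"
    by (simp flip: of_nat_sum)
  also have "\<dots> \<le> (\<Sum>i\<in>I. C * (d i / \<delta>) powr s0)"
    using cnt[OF T \<delta>(3)] by (intro sum_mono)
  also have "\<dots> = (C / \<delta> powr s0) * (\<Sum>i\<in>I. d i powr s0)"
    using \<delta> d_pos by (simp add: powr_divide less_imp_le sum_distrib_left)
  also have "\<dots> \<le> (C / \<delta> powr s0) * (2 * \<epsilon>)" using d_sum C by (intro mult_left_mono) auto
  finally have "real (card T) * \<delta> powr s0 \<le> 2 * \<epsilon> * C" using \<delta> by (simp add: field_simps)
  moreover have "1 \<le> real (card T) * \<delta> powr s0"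
  proof -
    have "1 = (\<Sum>u\<in>T. word_ratio u powr s0)" using cut_sum[OF Tc s0(2)] by simp
    also have "\<dots> \<le> (\<Sum>u\<in>T. \<delta> powr s0)"
      using TR word_ratio_pos[OF cut_letters[OF Tc]] s0 by (intro sum_mono powr_mono2) (auto intro: less_imp_le)
    finally show ?thesis by simp
  qed
  ultimately show False using \<epsilon> by linarith
qed

text \<open>This makes the infimum defining \<open>hausdorff_dim E\<close> run over a nonempty set.
  The exponent \<open>s + 1\<close> is far from sharp and allows a crude estimate: the cut at scale
  \<open>t\<close> has a total cost proportional to \<open>t\<close>.\<close>

lemma hausdorff_measure_null:
  assumes s: "0 \<le> s" "(\<Sum>i<m. \<rho> i powr s) = 1"
  shows "hausdorff_measure (s + 1) E = 0"
proof -
  define D where "D = diameter E"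
  have bE: "bounded E" using compact_imp_bounded[OF compact_E] .
  have D: "0 \<le> D" using diameter_ge_0[OF bE] D_def by simp
  have pre: "hausdorff_pre (s + 1) \<delta> E \<le> ennreal ((D powr (s + 1) * (1 / ratio_min) powr s) * t)"
    if \<delta>: "0 < \<delta>" and t: "0 < t" "t \<le> 1" "t * D \<le> \<delta>" for \<delta> t
  proof -
    obtain T where "scaled_cut t T" using scaled_cut_exists[OF t(1,2)] by (rule exE)
    then have T: "cut_set T" and R: "\<And>u. u \<in> T \<Longrightarrow> ratio_min * t \<le> word_ratio u \<and> word_ratio u \<le> t"
      by (auto simp: scaled_cut_def)
    obtain g where g: "bij_betw g {..<card T} T"
      using cut_finite[OF T] bij_betw_from_nat_into_finite by blast
    \<comment> \<open>Covers are indexed by all naturals; the empty sets beyond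
      \<open>card T\<close> have diameter 0 and cost \<open>0 powr (s + 1) = 0\<close>.\<close>
    define U where "U i = (if i < card T then word_map (g i) ` E else {})" for i
    have gT: "g i \<in> T" if "i < card T" for i using g that by (auto simp: bij_betw_def)
    have diam: "diameter (U i) \<le> t * D" for i
    proof (cases "i < card T")
      case True
      have "diameter (word_map (g i) ` E) \<le> t * D"
      proof (rule diameter_le)
        show "word_map (g i) ` E \<noteq> {} \<or> 0 \<le> t * D" using D t by simp
        fix y z assume "y \<in> word_map (g i) ` E" "z \<in> word_map (g i) ` E"
        then obtain y' z' where yz: "y' \<in> E" "z' \<in> E" "y = word_map (g i) y'" "z = word_map (g i) z'" by blast
        have "norm (y - z) = word_ratio (g i) * dist y' z'"
          using word_sim[OF cut_letters[OF T gT[OF True]]] yz by (simp flip: dist_norm)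
        also have "\<dots> \<le> t * D"
          using R[OF gT[OF True]] diameter_bounded_bound[OF bE yz(1,2)] t D_def by (intro mult_mono) auto
        finally show "norm (y - z) \<le> t * D" .
      qed
      then show ?thesis using True U_def by simp
    next
      case False
      then show ?thesis using D t U_def by simp
    qed
    have bU: "bounded (U i)" for i
    proof (cases "i < card T")
      case True
      have "U i \<subseteq> E" using U_def True word_map_in[OF cut_letters[OF T gT[OF True]]] by auto
      then show ?thesis using bE bounded_subset by blast
    qed (simp add: U_def)
    have "E \<subseteq> (\<Union>i. U i)"
    proof
      fix y assume "y \<in> E"
      then obtain w where w: "w \<in> T" "y \<in> word_map w ` E" using cut_cover[OF T] by blast
      then obtain i where "i < card T" "g i = w" using g unfolding bij_betw_def by (metis imageE lessThan_iff)
      then show "y \<in> (\<Union>i. U i)" using w U_def by auto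
    qed
    then have "hausdorff_pre (s + 1) \<delta> E \<le> (\<Sum>i. ennreal (diameter (U i) powr (s + 1)))"
      unfolding hausdorff_pre_def using bU order.trans[OF diam t(3)] by (intro INF_lower) auto
    also have "\<dots> = (\<Sum>i<card T. ennreal (diameter (U i) powr (s + 1)))"
      by (intro suminf_finite) (auto simp: U_def)
    also have "\<dots> \<le> (\<Sum>i<card T. ennreal ((t * D) powr (s + 1)))"
      using diam s diameter_ge_0[OF bU] by (intro sum_mono ennreal_leI powr_mono2) auto
    also have "\<dots> = ennreal (real (card T) * (t * D) powr (s + 1))"
      by (subst sum_ennreal) auto
    also have "\<dots> \<le> ennreal ((1 / (ratio_min * t)) powr s * (t * D) powr (s + 1))"
      using card_cut_le[OF T _ _ s, of "ratio_min * t"] R t ratio_bounds(1)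
      by (intro ennreal_leI mult_right_mono) auto
    also have "(1 / (ratio_min * t)) powr s * (t * D) powr (s + 1) = (D powr (s + 1) * (1 / ratio_min) powr s) * t"
      using t D ratio_bounds(1) by (simp add: powr_mult powr_divide powr_add)
    finally show ?thesis .
  qed
  have "hausdorff_pre (s + 1) \<delta> E \<le> 0" if "0 < \<delta>" for \<delta>
  proof (rule tendsto_lowerbound)
    let ?A = "D powr (s + 1) * (1 / ratio_min) powr s"
    have "((\<lambda>t. ennreal (?A * t)) \<longlongrightarrow> ennreal (?A * 0)) (at_right 0)"
      by (intro tendsto_intros)
    then show "((\<lambda>t. ennreal (?A * t)) \<longlongrightarrow> 0) (at_right 0)" by simp
    have "((\<lambda>t. t * D) \<longlongrightarrow> 0 * D) (at_right 0)" by (intro tendsto_intros)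
    then have "\<forall>\<^sub>F t in at_right 0. t * D < \<delta>" using that by (intro order_tendstoD(2)) auto
    moreover have "\<forall>\<^sub>F t in at_right (0::real). 0 < t" by (rule eventually_at_right_less)
    moreover have "\<forall>\<^sub>F t in at_right (0::real). t < 1" by (rule order_tendstoD(2)[OF tendsto_ident_at]) simp
    ultimately show "\<forall>\<^sub>F t in at_right 0. hausdorff_pre (s + 1) \<delta> E \<le> ennreal (?A * t)"
      by eventually_elim (intro pre that, auto)
  qed simp
  then have "hausdorff_measure (s + 1) E \<le> 0"
    unfolding hausdorff_measure_def by (intro SUP_least) auto
  then show ?thesis by simp
qed

text \<open>The Moran exponent is a lower bound for all positive exponents of vanishing Hausdorff
  measure, hence at most their infimum; enlarging the exponent weakens the Assouad bound because
  \<rho> / \<delta> >= 1.\<close>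

lemma attractor_assouad_dim:
  assumes s: "hausdorff_dim E \<le> s"
  shows "\<exists>C\<ge>0. assouad_bound C s E"
proof -
  obtain s0 where s0: "0 \<le> s0" "(\<Sum>i<m. \<rho> i powr s0) = 1" using moran_exponent by blast
  have "s0 \<le> hausdorff_dim E"
    unfolding hausdorff_dim_def
  proof (rule cInf_greatest)
    show "{s. 0 < s \<and> hausdorff_measure s E = 0} \<noteq> {}"
      using hausdorff_measure_null[OF s0] s0(1) by (auto intro!: exI[of _ "s0 + 1"])
  qed (use moran_exponent_le[OF s0] in auto)
  then have "s0 \<le> s" using s by linarith
  obtain C where "0 \<le> C" "assouad_bound C s0 E" using attractor_assouad[OF s0] by blast
  then show ?thesis using assouad_bound_mono[OF _ order_refl \<open>s0 \<le> s\<close>] by (intro exI[of _ C]) simp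
qed

end

section \<open>Nets of self-similar sets\<close>

definition separated :: "real \<Rightarrow> 'a::metric_space set \<Rightarrow> bool" where
  "separated a P \<longleftrightarrow> (\<forall>p\<in>P. \<forall>q\<in>P. p \<noteq> q \<longrightarrow> a \<le> dist p q)"

text \<open>A ball of radius \<open>a / 2\<close> contains at most one point of an
  \<open>a\<close>-separated set.\<close>

lemma card_separated_le:
  assumes E: "assouad_bound C s E" and P: "P \<subseteq> E \<inter> ball x r" "separated a P" and a: "0 < a" "a \<le> 2 * r"
  shows "finite P \<and> real (card P) \<le> C * (2 * r / a) powr s"
proof -
  obtain Q where Q: "finite Q" "real (card Q) \<le> C * (r / (a / 2)) powr s" "E \<inter> ball x r \<subseteq> (\<Union>y\<in>Q. ball y (a / 2))"
    using assouad_boundD[OF E, of "a / 2" r x] a by auto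
  have "\<exists>y. y \<in> Q \<and> dist y p < a / 2" if "p \<in> P" for p
  proof -
    have "p \<in> (\<Union>y\<in>Q. ball y (a / 2))" using that P(1) Q(3) by (meson subsetD)
    then show ?thesis by (simp add: Bex_def)
  qed
  then obtain g where g: "\<And>p. p \<in> P \<Longrightarrow> g p \<in> Q \<and> dist (g p) p < a / 2" by metis
  have "inj_on g P"
  proof (rule inj_onI, rule ccontr)
    fix p q assume pq: "p \<in> P" "q \<in> P" "g p = g q" "p \<noteq> q"
    have "dist p q \<le> dist (g p) p + dist (g p) q" by (rule dist_triangle3)
    also have "\<dots> < a" using g[OF pq(1)] g[OF pq(2)] pq(3) by simp
    finally have "dist p q < a" .
    moreover have "a \<le> dist p q" using P(2) pq unfolding separated_def by blast
    ultimately show False by linarith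
  qed
  moreover have "g ` P \<subseteq> Q" using g by blast
  ultimately have "finite P" "card P \<le> card Q"
    using Q(1) inj_on_finite card_inj_on_le by metis+
  then show ?thesis using Q(2) by (simp add: mult.commute)
qed

text \<open>Separated subsets of \<open>E\<close> have bounded cardinality, so one of largest
  cardinality exists; a point of \<open>E\<close> at distance at least \<open>a\<close> from all of
  it could be added.\<close>

lemma maximal_separated:
  assumes E: "assouad_bound C s E" "E \<subseteq> ball x r" and a: "0 < a" "a \<le> 2 * r"
  obtains P where "finite P" "P \<subseteq> E" "separated a P" "E \<subseteq> (\<Union>p\<in>P. ball p a)"
proof -
  have bd: "finite P \<and> real (card P) \<le> C * (2 * r / a) powr s" if "P \<subseteq> E \<and> separated a P" for P
    using card_separated_le[OF E(1) _ _ a] that E(2) by blast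
  have "\<forall>P. P \<subseteq> E \<and> separated a P \<longrightarrow> card P < Suc (nat \<lfloor>C * (2 * r / a) powr s\<rfloor>)"
    using bd by (auto simp: le_nat_floor less_Suc_eq_le)
  moreover have "{} \<subseteq> E \<and> separated a {}" by (simp add: separated_def)
  ultimately have "\<exists>P. (P \<subseteq> E \<and> separated a P) \<and> (\<forall>P'. P' \<subseteq> E \<and> separated a P' \<longrightarrow> card P' \<le> card P)"
    by (intro ex_has_greatest_nat)
  then obtain P where Pm: "(P \<subseteq> E \<and> separated a P) \<and> (\<forall>P'. P' \<subseteq> E \<and> separated a P' \<longrightarrow> card P' \<le> card P)"
    by (rule exE)
  note P = conjunct1[OF Pm] and max = conjunct2[OF Pm]
  have fin: "finite P" using bd[OF P] by simp
  have "\<exists>p\<in>P. dist p z < a" if z: "z \<in> E" for z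
  proof (rule ccontr)
    assume "\<not> (\<exists>p\<in>P. dist p z < a)"
    then have far: "\<And>p. p \<in> P \<Longrightarrow> a \<le> dist p z" by (simp add: not_less)
    then have "z \<notin> P" using a(1) by fastforce
    have "insert z P \<subseteq> E \<and> separated a (insert z P)"
      using P z far by (auto simp: separated_def dist_commute)
    then have "card (insert z P) \<le> card P" by (rule max[rule_format])
    then show False using \<open>z \<notin> P\<close> fin by simp
  qed
  then have "E \<subseteq> (\<Union>p\<in>P. ball p a)" by auto
  then show ?thesis using that[of P] fin P by simp
qed

text \<open>A single \<open>K\<close> bounds the size of \<open>E\<close>, the Assouad constant and,
  from below, the gap between the ratios and 1. The open set condition is recorded through the
  Assouad bound, the form in which counting uses it.\<close>

definition ss_class :: "nat \<Rightarrow> real \<Rightarrow> real \<Rightarrow> 'a::euclidean_space set \<Rightarrow> bool" where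
  "ss_class m K s E \<longleftrightarrow> compact E \<and> E \<noteq> {} \<and> E \<subseteq> cball 0 K \<and> assouad_bound K s E \<and>
     (\<exists>f. (\<forall>i<m. \<exists>\<rho>\<le>1 - 1 / K. similarity \<rho> (f i)) \<and> E = (\<Union>i<m. f i ` E))"

lemma self_similar_osc_class:
  fixes E :: "'a::euclidean_space set"
  assumes "self_similar_osc E" "hausdorff_dim E \<le> s"
  shows "\<exists>m (K::nat). 1 \<le> K \<and> ss_class m (real K) s E"
proof -
  obtain fs where fs: "fs \<noteq> []" "\<And>f. f \<in> set fs \<Longrightarrow> contracting_similarity f" "ifs_attractor fs E" "open_set_condition fs"
    using assms(1) unfolding self_similar_osc_def by blast
  define m where "m = length fs"
  define f where "f i = fs ! i" for i
  have "\<forall>i. \<exists>\<rho>. i < m \<longrightarrow> 0 < \<rho> \<and> \<rho> < 1 \<and> (\<forall>x y. dist (f i x) (f i y) = \<rho> * dist x y)"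
    using fs(2) unfolding contracting_similarity_def m_def f_def by (metis nth_mem)
  then obtain \<rho> where "\<forall>i. i < m \<longrightarrow> 0 < \<rho> i \<and> \<rho> i < 1 \<and> (\<forall>x y. dist (f i x) (f i y) = \<rho> i * dist x y)"
    using choice by metis
  then have \<rho>: "\<And>i. i < m \<Longrightarrow> 0 < \<rho> i \<and> \<rho> i < 1"
    and sim: "\<And>i x y. i < m \<Longrightarrow> dist (f i x) (f i y) = \<rho> i * dist x y" by auto
  have m: "0 < m" using fs(1) m_def by simp
  have img: "(\<Union>g\<in>set fs. g ` E) = (\<Union>i<m. f i ` E)"
    unfolding m_def f_def by (fastforce simp: set_conv_nth)
  then have E: "compact E" "E \<noteq> {}" and att: "E = (\<Union>i<m. f i ` E)"
    using fs(3) by (simp_all add: ifs_attractor_def)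
  obtain V where "open V \<and> V \<noteq> {} \<and> (\<forall>g \<in> set fs. g ` V \<subseteq> V) \<and>
     (\<forall>i < length fs. \<forall>j < length fs. i \<noteq> j \<longrightarrow> (fs ! i) ` V \<inter> (fs ! j) ` V = {})"
    using fs(4) unfolding open_set_condition_def by (rule exE)
  then have V: "open V" "V \<noteq> {}" "\<And>g. g \<in> set fs \<Longrightarrow> g ` V \<subseteq> V"
    "\<And>i j. i < m \<Longrightarrow> j < m \<Longrightarrow> i \<noteq> j \<Longrightarrow> f i ` V \<inter> f j ` V = {}"
    unfolding m_def f_def by simp_all
  have Vs: "f i ` V \<subseteq> V" if "i < m" for i using V(3)[of "f i"] that by (simp add: f_def m_def)
  interpret osc_ifs f \<rho> m E V
    by unfold_locales (fact m \<rho> sim E att V(1,2) Vs V(4))+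
  obtain C where C: "0 \<le> C" "assouad_bound C s E" using attractor_assouad_dim[OF assms(2)] by blast
  obtain B where B: "\<And>x. x \<in> E \<Longrightarrow> norm x \<le> B"
    using compact_imp_bounded[OF E(1)] by (auto simp: bounded_iff)
  obtain K :: nat where "max (max 1 C) (max B (1 / (1 - ratio_max))) \<le> real K"
    using real_arch_simple by blast
  then have K: "1 \<le> real K" "C \<le> real K" "B \<le> real K" "1 / (1 - ratio_max) \<le> real K" by simp_all
  have "1 / real K \<le> 1 - ratio_max"
    using K(1,4) ratio_bounds(2) by (simp add: field_simps)
  then have "\<And>i. i < m \<Longrightarrow> \<rho> i \<le> 1 - 1 / real K" using ratio_bounds(3) by fastforce
  then have "\<forall>i<m. \<exists>r\<le>1 - 1 / real K. similarity r (f i)"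
    using \<rho> sim unfolding similarity_def by meson
  moreover have "E \<subseteq> cball 0 (real K)" using B K(3) by fastforce
  moreover have "assouad_bound (real K) s E" using assouad_bound_mono[OF C(2) K(2) order_refl C(1)] .
  ultimately have "ss_class m (real K) s E" unfolding ss_class_def using E att by blast
  moreover have "1 \<le> K" using K(1) by simp
  ultimately show ?thesis by blast
qed

text \<open>Let \<open>z = f i y\<close> be a point of \<open>E\<close> farthest from
  \<open>E'\<close>, at distance \<open>h\<close>. Replacing \<open>f i\<close> by
  \<open>g i\<close> and contracting gives \<open>h <= \<delta> * c + (1 - c) * h\<close>. Closeness
  is one-sided, since \<open>E\<close> is to be covered from \<open>E'\<close> and not
  conversely.\<close>

lemma attractor_close:
  fixes E E' :: "'a::euclidean_space set"
  assumes E: "compact E" "E = (\<Union>i<m. f i ` E)"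
    and E': "closed E'" "E' \<noteq> {}" "\<And>i. i < m \<Longrightarrow> g i ` E' \<subseteq> E'"
    and g: "\<And>i x y. i < m \<Longrightarrow> dist (g i x) (g i y) \<le> (1 - c) * dist x y" and c: "0 < c" "c \<le> 1"
    and close: "\<And>i x. i < m \<Longrightarrow> x \<in> E \<Longrightarrow> dist (f i x) (g i x) \<le> \<delta> * c"
    and x: "x \<in> E"
  shows "\<exists>y\<in>E'. dist x y \<le> \<delta>"
proof -
  have "continuous_on E (\<lambda>x. infdist x E')" by (intro continuous_intros)
  then obtain z where z: "z \<in> E" "\<And>y. y \<in> E \<Longrightarrow> infdist y E' \<le> infdist z E'"
    using continuous_attains_sup[OF E(1)] x by blast
  define h where "h = infdist z E'"
  have "z \<in> (\<Union>i<m. f i ` E)" using z(1) E(2) by (rule subst[rotated])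
  then obtain i y where i: "i < m" "y \<in> E" "z = f i y" by auto
  obtain y' where y': "y' \<in> E'" "infdist y E' = dist y y'" using infdist_attains_inf[OF E'(1,2)] by metis
  have "h \<le> dist z (g i y')" unfolding h_def using E'(3)[OF i(1)] y'(1) by (intro infdist_le) auto
  also have "\<dots> \<le> dist (f i y) (g i y) + dist (g i y) (g i y')" unfolding i(3) by (rule dist_triangle)
  also have "\<dots> \<le> \<delta> * c + (1 - c) * h"
  proof (rule add_mono[OF close[OF i(1,2)]])
    have "(1 - c) * dist y y' \<le> (1 - c) * h"
      using z(2)[OF i(2)] y'(2) c unfolding h_def by (intro mult_left_mono) auto
    then show "dist (g i y) (g i y') \<le> (1 - c) * h" using g[OF i(1), of y y'] by linarith
  qed
  finally have "h * c \<le> \<delta> * c" by (simp add: algebra_simps)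
  then have "h \<le> \<delta>" using c by simp
  obtain w where "w \<in> E'" "infdist x E' = dist x w" using infdist_attains_inf[OF E'(1,2)] by metis
  then show ?thesis using z(2)[OF x] \<open>h \<le> \<delta>\<close> h_def by (intro bexI[of _ w]) auto
qed

text \<open>Round the coordinates of the images of 0 and of the basis vectors to a grid of mesh
  \<open>1 / N\<close>, and pick one set of the class from each occupied cell. The number of cells
  is polynomial in \<open>1 / \<delta>\<close>, with exponent \<open>card I\<close> independent of
  \<delta>.\<close>

lemma ss_class_net:
  assumes K: "1 \<le> K"
  shows "\<exists>A L. \<forall>\<delta>. 0 < \<delta> \<longrightarrow> \<delta> \<le> 1 \<longrightarrow> (\<exists>F. finite F \<and> (\<forall>E\<in>F. ss_class m K s E) \<and>
     real (card F) \<le> A * (1 / \<delta>) ^ L \<and>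
     (\<forall>E :: 'a::euclidean_space set. ss_class m K s E \<longrightarrow> (\<exists>E'\<in>F. \<forall>x\<in>E. \<exists>y\<in>E'. dist x y \<le> \<delta>)))"
proof -
  define I where "I = {..<m} \<times> insert 0 (Basis::'a set) \<times> (Basis::'a set)"
  have finI: "finite I" by (simp add: I_def)
  define d where "d = real DIM('a)"
  have d: "1 \<le> d" using DIM_positive[where 'a='a] unfolding d_def by linarith
  \<comment> \<open>Origin of the factors: \<open>d\<close> from bounding a norm by its
    \<open>d\<close> coordinates, \<open>1 + 2 * d * K\<close> from
    \<open>similarity_dist_le\<close> on \<open>cball 0 K\<close>, and \<open>K\<close> because
    \<open>attractor_close\<close> is applied with \<open>c = 1 / K\<close>.\<close>
  define B where "B = d * (K * (1 + 2 * d * K))"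
  have B: "1 \<le> B" unfolding B_def
    using d K by (intro mult_ge1_I) auto
  have "\<exists>f. (\<forall>i<m. \<exists>\<rho>\<le>1 - 1 / K. similarity \<rho> (f i)) \<and> E = (\<Union>i<m. f i ` E)" if "ss_class m K s E" for E :: "'a set"
    using that unfolding ss_class_def by simp
  then obtain \<phi> where \<phi>: "\<And>(E::'a set) i. ss_class m K s E \<Longrightarrow> i < m \<Longrightarrow> \<exists>\<rho>\<le>1 - 1 / K. similarity \<rho> (\<phi> E i)"
    and \<phi>E: "\<And>E::'a set. ss_class m K s E \<Longrightarrow> E = (\<Union>i<m. \<phi> E i ` E)" by metis
  have "\<exists>F. finite F \<and> (\<forall>E\<in>F. ss_class m K s E) \<and>
     real (card F) \<le> (2 * B * (2 * K + 1) + 3) ^ card I * (1 / \<delta>) ^ card I \<and>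
     (\<forall>E :: 'a set. ss_class m K s E \<longrightarrow> (\<exists>E'\<in>F. \<forall>x\<in>E. \<exists>y\<in>E'. dist x y \<le> \<delta>))"
    if \<delta>: "0 < \<delta>" "\<delta> \<le> 1" for \<delta>
  proof -
    define N where "N = B / \<delta>"
    have N: "0 < N" using B \<delta> by (simp add: N_def)
    define z where "z = \<lceil>N * (2 * K + 1)\<rceil>"
    have "0 \<le> N * (2 * K + 1)" using N K by simp
    then have z0: "0 \<le> z" 
      using le_of_int_ceiling[of "N * (2 * K + 1)"] unfolding z_def[symmetric] by (meson order.trans of_int_0_le_iff)
    define code where "code E = (\<lambda>(i, e, b)\<in>I. \<lfloor>N * (\<phi> E i e \<bullet> b)\<rfloor>)" for E
    \<comment> \<open>Translations are bounded by invariance: \<open>\<phi> E i\<close> sends some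
      point of \<open>cball 0 K\<close> into \<open>cball 0 K\<close> and does not expand
      distances.\<close>
    have bnd: "\<bar>\<phi> E i e \<bullet> b\<bar> \<le> 2 * K + 1"
      if E: "ss_class m K s E" and i: "i < m" and e: "e \<in> insert 0 Basis" and b: "b \<in> Basis" for E i e b
    proof -
      obtain y where y: "y \<in> E" using E unfolding ss_class_def by blast
      have yn: "norm y \<le> K" using E y unfolding ss_class_def by auto
      have "\<phi> E i y \<in> (\<Union>i<m. \<phi> E i ` E)" using y i by blast
      then have "\<phi> E i y \<in> E" using \<phi>E[OF E] by (rule ssubst[rotated])
      then have yn': "norm (\<phi> E i y) \<le> K" using E unfolding ss_class_def by auto
      obtain \<rho> where \<rho>: "\<rho> \<le> 1 - 1 / K" "similarity \<rho> (\<phi> E i)" using \<phi>[OF E i] by blast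
      have e1: "norm e \<le> 1" using e by auto
      have "dist (\<phi> E i e) (\<phi> E i y) \<le> 1 * dist e y"
        unfolding similarityD(2)[OF \<rho>(2)] using \<rho>(1) K by (intro mult_right_mono order.trans[OF \<rho>(1)]) auto
      also have "\<dots> \<le> 1 + K" using norm_triangle_ineq4[of e y] e1 yn by (simp add: dist_norm)
      finally have "norm (\<phi> E i e) \<le> 2 * K + 1"
        using norm_triangle_ineq2[of "\<phi> E i e" "\<phi> E i y"] yn' by (simp add: dist_norm)
      then show ?thesis using Basis_le_norm[OF b, of "\<phi> E i e"] by linarith
    qed
    have codes: "code ` {E. ss_class m K s E} \<subseteq> I \<rightarrow>\<^sub>E {- z..z}"
    proof
      fix c assume "c \<in> code ` {E. ss_class m K s E}"
      then obtain E where E: "ss_class m K s E" "c = code E" by blast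
      have "\<lfloor>N * (\<phi> E i e \<bullet> b)\<rfloor> \<in> {- z..z}" if "i < m" "e \<in> insert 0 Basis" "b \<in> Basis" for i e b
      proof -
        have "\<bar>N * (\<phi> E i e \<bullet> b)\<bar> \<le> N * (2 * K + 1)"
          unfolding abs_mult using bnd[OF E(1) that] N by (intro mult_mono) auto
        also have "\<dots> \<le> of_int z" unfolding z_def by (rule le_of_int_ceiling)
        finally have "- of_int z \<le> N * (\<phi> E i e \<bullet> b)" "N * (\<phi> E i e \<bullet> b) \<le> of_int z" by linarith+
        then show ?thesis by (simp add: le_floor_iff floor_le_iff)
      qed
      then show "c \<in> I \<rightarrow>\<^sub>E {- z..z}" unfolding E(2) code_def I_def by (intro restrict_PiE_iff[THEN iffD2]) auto
    qed
    have finP: "finite (I \<rightarrow>\<^sub>E {- z..z})" by (intro finite_PiE finI) auto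
    define rep where "rep c = (SOME E. ss_class m K s E \<and> code E = c)" for c
    define F where "F = rep ` code ` {E. ss_class m K s E}"
    have rep: "ss_class m K s (rep (code E)) \<and> code (rep (code E)) = code E" if "ss_class m K s E" for E
      unfolding rep_def by (rule someI[of "\<lambda>E'. ss_class m K s E' \<and> code E' = code E" E]) (simp add: that)
    have fin: "finite (code ` {E. ss_class m K s E})" using finite_subset[OF codes finP] .
    have "card F \<le> card (code ` {E. ss_class m K s E})" unfolding F_def by (rule card_image_le[OF fin])
    also have "\<dots> \<le> card (I \<rightarrow>\<^sub>E {- z..z})" by (rule card_mono[OF finP codes])
    also have "\<dots> = nat (2 * z + 1) ^ card I" using finI z0 by (simp add: card_PiE)
    finally have "real (card F) \<le> real (nat (2 * z + 1)) ^ card I" by (metis of_nat_le_iff of_nat_power)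
    also have "\<dots> \<le> ((2 * B * (2 * K + 1) + 3) * (1 / \<delta>)) ^ card I"
    proof (intro power_mono)
      have "real (nat (2 * z + 1)) = 2 * of_int z + 1" using z0 by simp
      also have "\<dots> \<le> 2 * (N * (2 * K + 1) + 1) + 1"
        using of_int_ceiling_le_add_one[of "N * (2 * K + 1)"] unfolding z_def[symmetric] by argo
      also have "\<dots> \<le> (2 * B * (2 * K + 1) + 3) * (1 / \<delta>)"
        using \<delta> unfolding N_def by (simp add: field_simps)
      finally show "real (nat (2 * z + 1)) \<le> (2 * B * (2 * K + 1) + 3) * (1 / \<delta>)" .
    qed simp
    finally have card: "real (card F) \<le> (2 * B * (2 * K + 1) + 3) ^ card I * (1 / \<delta>) ^ card I"
      unfolding power_mult_distrib .
    have near: "\<exists>E'\<in>F. \<forall>x\<in>E. \<exists>y\<in>E'. dist x y \<le> \<delta>" if E: "ss_class m K s E" for E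
    proof
      define E' where "E' = rep (code E)"
      show "rep (code E) \<in> F" unfolding F_def using E by blast
      have E': "ss_class m K s E'" "code E' = code E" using rep[OF E] E'_def by auto
      have cl: "dist (\<phi> E i e) (\<phi> E' i e) \<le> d / N" if i: "i < m" and e: "e \<in> insert 0 Basis" for i e
      proof -
        have "\<bar>(\<phi> E i e - \<phi> E' i e) \<bullet> b\<bar> \<le> 1 / N" if b: "b \<in> Basis" for b
        proof -
          have "(i, e, b) \<in> I" using i e b by (simp add: I_def)
          then have "\<lfloor>N * (\<phi> E i e \<bullet> b)\<rfloor> = \<lfloor>N * (\<phi> E' i e \<bullet> b)\<rfloor>"
            using fun_cong[OF E'(2), of "(i, e, b)"] by (simp add: code_def)
          then have "\<bar>N * (\<phi> E i e \<bullet> b) - N * (\<phi> E' i e \<bullet> b)\<bar> \<le> 1" by linarith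
          then have "N * \<bar>(\<phi> E i e - \<phi> E' i e) \<bullet> b\<bar> \<le> 1"
            using N by (simp add: inner_diff_left abs_mult flip: right_diff_distrib)
          then show ?thesis using N by (simp add: field_simps)
        qed
        then have "(\<Sum>b\<in>Basis. \<bar>(\<phi> E i e - \<phi> E' i e) \<bullet> b\<bar>) \<le> (\<Sum>b\<in>(Basis::'a set). 1 / N)" by (rule sum_mono)
        then show ?thesis using norm_le_l1[of "\<phi> E i e - \<phi> E' i e"] by (simp add: dist_norm d_def)
      qed
      have clx: "dist (\<phi> E i x) (\<phi> E' i x) \<le> \<delta> * (1 / K)" if i: "i < m" and x: "x \<in> E" for i x
      proof -
        obtain \<rho> \<sigma> where "similarity \<rho> (\<phi> E i)" "similarity \<sigma> (\<phi> E' i)" using \<phi>[OF E i] \<phi>[OF E'(1) i] by blast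
        then have "dist (\<phi> E i x) (\<phi> E' i x) \<le> (1 + 2 * real DIM('a) * norm x) * (d / N)"
          using cl[OF i] by (rule similarity_dist_le)
        also have "\<dots> \<le> (1 + 2 * d * K) * (d / N)"
          using E x d N unfolding ss_class_def d_def[symmetric]
          by (intro mult_right_mono add_left_mono mult_left_mono) auto
        also have "\<dots> = \<delta> * (1 / K)"
        proof -
          define w where "w = 1 + 2 * d * K"
          have "0 < w" using d K by (simp add: w_def add_pos_nonneg)
          then show ?thesis using d K \<delta> unfolding N_def B_def w_def[symmetric] by simp
        qed
        finally show ?thesis .
      qed
      show "\<forall>x\<in>E. \<exists>y\<in>rep (code E). dist x y \<le> \<delta>"
        unfolding E'_def[symmetric]
      proof
        fix x assume x: "x \<in> E"
        show "\<exists>y\<in>E'. dist x y \<le> \<delta>"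
        proof (rule attractor_close[where E = E and E' = E' and \<delta> = \<delta> and x = x and f = "\<phi> E" and g = "\<phi> E'" and c = "1 / K" and m = m])
          show "compact E" using E unfolding ss_class_def by simp
          show "E = (\<Union>i<m. \<phi> E i ` E)" using \<phi>E[OF E] .
          show "closed E'" "E' \<noteq> {}" using E'(1) compact_imp_closed unfolding ss_class_def by auto
          show "\<phi> E' i ` E' \<subseteq> E'" if "i < m" for i using \<phi>E[OF E'(1)] that by blast
          show "dist (\<phi> E' i x) (\<phi> E' i y) \<le> (1 - 1 / K) * dist x y" if i: "i < m" for i x y
          proof -
            obtain \<rho> where "\<rho> \<le> 1 - 1 / K" "similarity \<rho> (\<phi> E' i)" using \<phi>[OF E'(1) i] by blast
            then show ?thesis by (simp add: similarityD(2) mult_right_mono)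
          qed
          show "0 < 1 / K" "1 / K \<le> 1" using K by auto
        qed (use clx x in auto)
      qed
    qed
    have inF: "\<forall>E\<in>F. ss_class m K s E" using rep by (auto simp: F_def)
    have finF: "finite F" unfolding F_def using fin by (rule finite_imageI)
    show ?thesis by (rule exI[of _ F], intro conjI finF inF card allI impI near)
  qed
  then show ?thesis
    by (intro exI[of _ "(2 * B * (2 * K + 1) + 3) ^ card I"] exI[of _ "card I"] allI impI)
qed

section \<open>Void probabilities and moments of the number of surviving points\<close>

text \<open>For \<beta> = 1/2 these are the parameters of the cutout balls of diameter in [a,c) that
  contain \<open>x\<close>; a smaller \<beta> asks \<open>x\<close> to lie in the concentric ball of
  radius \<beta> times the diameter.\<close>

definition cone :: "real \<Rightarrow> real \<Rightarrow> real \<Rightarrow> 'a::euclidean_space \<Rightarrow> ('a \<times> real) set" where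
  "cone \<beta> a c x = {p. a \<le> snd p \<and> snd p < c \<and> dist x (snd p *\<^sub>R fst p) < \<beta> * snd p}"

lemma cone_borel [measurable]: "cone \<beta> a c x \<in> sets borel"
proof -
  have "cone \<beta> a c x = {p. a \<le> snd p} \<inter> ({p. snd p < c} \<inter> {p. dist x (snd p *\<^sub>R fst p) < \<beta> * snd p})"
    by (auto simp: cone_def)
  also have "\<dots> \<in> sets borel"
    by (intro sets.Int borel_closed borel_open closed_Collect_le open_Collect_less continuous_intros)
  finally show ?thesis .
qed

lemma sets_ball_cutout_intensity [simp, measurable_cong]: "sets (ball_cutout_intensity r) = sets borel"
  by (simp add: ball_cutout_intensity_def)

text \<open>At scale \<open>s\<close> the admissible \<open>t\<close> form the ball of radius
  \<beta> about \<open>x / s\<close>, whose volume depends neither on \<open>s\<close> nor on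
  \<open>x\<close>; the density \<open>r / s\<close> integrates to a logarithm. Hence void
  probabilities are powers of the scale.\<close>

lemma emeasure_cone:
  fixes x :: "'a::euclidean_space"
  assumes "0 \<le> r" "0 < a" "a \<le> c" "0 \<le> \<beta>"
  shows "emeasure (ball_cutout_intensity r) (cone \<beta> a c x)
    = ennreal (r * (unit_ball_vol (real DIM('a)) * \<beta> ^ DIM('a)) * ln (c / a))"
proof -
  define v where "v = unit_ball_vol (real DIM('a)) * \<beta> ^ DIM('a)"
  have v: "0 \<le> v" using assms unfolding v_def by simp
  let ?w = "\<lambda>p :: 'a \<times> real. if 0 < snd p then ennreal (r / snd p) else 0"
  have w: "(\<lambda>(t :: 'a, s). if 0 < s then ennreal (r / s) else 0) = ?w" by (auto simp: fun_eq_iff)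
  have "?w \<in> borel_measurable (borel \<Otimes>\<^sub>M borel)" by measurable
  then have [measurable]: "?w \<in> borel_measurable borel" by (simp only: borel_prod)
  have "emeasure (ball_cutout_intensity r) (cone \<beta> a c x) = (\<integral>\<^sup>+p. ?w p * indicator (cone \<beta> a c x) p \<partial>lborel)"
    unfolding ball_cutout_intensity_def w by (intro emeasure_density) auto
  also have "\<dots> = (\<integral>\<^sup>+s. \<integral>\<^sup>+t. ?w (t, s) * indicator (cone \<beta> a c x) (t, s) \<partial>lborel \<partial>lborel)"
    unfolding lborel_prod[symmetric]
    by (intro lborel_pair.nn_integral_snd[symmetric]) (simp add: lborel_prod)
  also have "\<dots> = (\<integral>\<^sup>+s. ennreal (r * v / s) * indicator {a..<c} s \<partial>lborel)"
  proof (intro nn_integral_cong)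
    fix s :: real
    show "(\<integral>\<^sup>+t. ?w (t, s) * indicator (cone \<beta> a c x) (t, s) \<partial>lborel) = ennreal (r * v / s) * indicator {a..<c} s"
    proof (cases "s \<in> {a..<c}")
      case True
      then have s: "0 < s" using assms by simp
      have "indicator (cone \<beta> a c x) (t, s) = (indicator (ball (x /\<^sub>R s) \<beta>) t :: ennreal)" for t
      proof -
        have "dist x (s *\<^sub>R t) = dist (s *\<^sub>R (x /\<^sub>R s)) (s *\<^sub>R t)" using s by simp
        also have "\<dots> = s * dist (x /\<^sub>R s) t" using s unfolding dist_norm scaleR_diff_right[symmetric] norm_scaleR by simp
        finally show ?thesis using True s by (auto simp: cone_def indicator_def mult.commute)
      qed
      then have "(\<integral>\<^sup>+t. ?w (t, s) * indicator (cone \<beta> a c x) (t, s) \<partial>lborel)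
          = (\<integral>\<^sup>+t. ennreal (r / s) * indicator (ball (x /\<^sub>R s) \<beta>) t \<partial>lborel)"
        using s by simp
      also have "\<dots> = ennreal (r / s) * emeasure lborel (ball (x /\<^sub>R s) \<beta>)"
        by (intro nn_integral_cmult_indicator) auto
      also have "\<dots> = ennreal (r / s) * ennreal v" using emeasure_ball[OF assms(4), of "x /\<^sub>R s"] by (simp add: v_def)
      also have "\<dots> = ennreal (r * v / s)" using v s assms by (simp flip: ennreal_mult)
      finally show ?thesis using True by simp
    next
      case False
      then have "(t, s) \<notin> cone \<beta> a c x" for t by (auto simp: cone_def)
      then show ?thesis using False by simp
    qed
  qed
  also have "\<dots> = (\<integral>\<^sup>+s. ennreal (r * v / s) * indicator {a..c} s \<partial>lborel)"
    using AE_lborel_singleton[of c] by (intro nn_integral_cong_AE) (auto simp: indicator_def)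
  also have "\<dots> = ennreal (r * v * ln c - r * v * ln a)"
    using assms v by (intro nn_integral_FTC_Icc) (auto intro!: derivative_eq_intros)
  finally show ?thesis using assms by (simp add: v_def ln_div right_diff_distrib)
qed

definition cone_union :: "real \<Rightarrow> real \<Rightarrow> 'a::euclidean_space set \<Rightarrow> ('a \<times> real) set" where
  "cone_union \<beta> b X = (\<Union>x\<in>X. cone \<beta> b 1 x)"

section \<open>Survival of finite point sets: void probabilities, decoupling, moments\<close>

locale ball_cutout =
  fixes M :: "'w measure" and Y :: "'w \<Rightarrow> ('a::euclidean_space \<times> real) set" and r :: real
  assumes r: "0 < r" and ppp: "poisson_point_process M (ball_cutout_intensity r) Y"
begin

abbreviation "\<nu> \<equiv> ball_cutout_intensity r :: ('a \<times> real) measure"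

sublocale prob_space M
  using ppp unfolding poisson_point_process_def by blast

text \<open>The cardinality of an infinite set is 0, so this contains the null event of infinitely many hits.\<close>

definition unhit :: "real \<Rightarrow> real \<Rightarrow> 'a set \<Rightarrow> 'w set" where
  "unhit \<beta> b X = {\<omega> \<in> space M. card (Y \<omega> \<inter> cone_union \<beta> b X) = 0}"

text \<open>A single point survives down to scale \<open>b\<close> with probability
  \<open>b powr cone_exponent \<beta>\<close>; at \<beta> = 1/2 the exponent is \<alpha>.\<close>

definition cone_exponent :: "real \<Rightarrow> real" where
  "cone_exponent \<beta> = r * (unit_ball_vol (real DIM('a)) * \<beta> ^ DIM('a))"

lemma cone_exponent_nonneg: "0 \<le> \<beta> \<Longrightarrow> 0 \<le> cone_exponent \<beta>"
  using r by (simp add: cone_exponent_def)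

text \<open>The distance is clipped to [b,1]: points closer than \<open>b\<close> gain nothing
  (value 1), and from distance 1 on the cones, cut off at scale 1, are disjoint.\<close>

definition decay :: "real \<Rightarrow> real \<Rightarrow> real \<Rightarrow> real" where
  "decay \<beta> b t = (b / max b (min t 1)) powr cone_exponent \<beta>"

lemma decay_nonneg: "0 \<le> decay \<beta> b t" by (simp add: decay_def)

context
  fixes \<beta> b :: real
  assumes \<beta>: "0 \<le> \<beta>" "\<beta> \<le> 1 / 2" and b: "0 < b" "b \<le> 1"
begin

lemma cone_union_borel [measurable]: "finite X \<Longrightarrow> cone_union \<beta> b X \<in> sets borel"
  unfolding cone_union_def by (intro sets.finite_UN) auto

lemma cone_union_finite:
  assumes "finite X"
  shows "emeasure \<nu> (cone_union \<beta> b X) < \<infinity>"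
proof -
  have "emeasure \<nu> (cone_union \<beta> b X) \<le> (\<Sum>x\<in>X. emeasure \<nu> (cone \<beta> b 1 x))"
    unfolding cone_union_def using assms by (intro emeasure_subadditive_finite) auto
  also have "\<dots> = (\<Sum>x\<in>X. ennreal (cone_exponent \<beta> * ln (1 / b)))"
    using emeasure_cone[of r b 1 \<beta> "x :: 'a" for x] r b \<beta> by (simp add: cone_exponent_def)
  also have "\<dots> < \<infinity>" using b \<beta> by (subst sum_ennreal) (auto intro!: mult_nonneg_nonneg cone_exponent_nonneg)
  finally show ?thesis .
qed

lemma unhit_sets [measurable]: "finite X \<Longrightarrow> unhit \<beta> b X \<in> sets M"
  and AE_finite: "finite X \<Longrightarrow> AE \<omega> in M. finite (Y \<omega> \<inter> cone_union \<beta> b X)"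
  and prob_unhit: "finite X \<Longrightarrow> prob (unhit \<beta> b X) = exp (- measure \<nu> (cone_union \<beta> b X))"
proof -
  assume X: "finite X"
  let ?B = "cone_union \<beta> b X"
  have *: "?B \<in> sets borel" "emeasure \<nu> ?B < \<infinity>" using X cone_union_finite by auto
  then have AE: "AE \<omega> in M. finite (Y \<omega> \<inter> ?B)"
    and meas: "(\<lambda>\<omega>. card (Y \<omega> \<inter> ?B)) \<in> measurable M (count_space UNIV)"
    and pr: "prob {\<omega> \<in> space M. card (Y \<omega> \<inter> ?B) = 0} = measure \<nu> ?B ^ 0 / fact 0 * exp (- measure \<nu> ?B)"
    using ppp unfolding poisson_point_process_def by blast+
  show "AE \<omega> in M. finite (Y \<omega> \<inter> ?B)" by (rule AE)
  show "prob (unhit \<beta> b X) = exp (- measure \<nu> ?B)" using pr by (simp add: unhit_def)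
  have "unhit \<beta> b X = (\<lambda>\<omega>. card (Y \<omega> \<inter> ?B)) -` {0} \<inter> space M" by (auto simp: unhit_def)
  then show "unhit \<beta> b X \<in> sets M" using measurable_sets[OF meas, of "{0}"] by simp
qed

text \<open>The part of the cone of \<open>j\<close> at scales below \<open>t\<close> avoids the
  cones of all \<open>x\<close> in \<open>X\<close>, as a common point of scale \<open>s\<close>
  would give dist j x < 2 \<beta> s <= s. So this part adds its full measure to the union, and the
  void probability gains a factor.\<close>

lemma prob_unhit_insert:
  assumes X: "finite X" and t: "\<And>x. x \<in> X \<Longrightarrow> t \<le> dist j x"
  shows "prob (unhit \<beta> b (insert j X)) \<le> prob (unhit \<beta> b X) * decay \<beta> b t"
proof -
  define c where "c = max b (min t 1)"
  have c: "b \<le> c" "c \<le> 1" "0 < c" using b by (auto simp: c_def)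
  have disj: "cone_union \<beta> b X \<inter> cone \<beta> b c j = {}"
  proof (rule ccontr)
    assume "cone_union \<beta> b X \<inter> cone \<beta> b c j \<noteq> {}"
    then obtain p x where p: "x \<in> X" "p \<in> cone \<beta> b 1 x" "p \<in> cone \<beta> b c j"
      by (auto simp: cone_union_def)
    then have s: "b \<le> snd p" "snd p < c" by (auto simp: cone_def)
    have "dist j x \<le> dist j (snd p *\<^sub>R fst p) + dist x (snd p *\<^sub>R fst p)" by (rule dist_triangle2)
    also have "\<dots> < \<beta> * snd p + \<beta> * snd p" using p by (auto simp: cone_def)
    also have "\<dots> \<le> snd p" using mult_right_mono[OF \<beta>(2), of "snd p"] s b by simp
    finally have "dist j x < c" "b < c" using s by auto
    then show False using t[OF p(1)] by (auto simp: c_def)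
  qed
  have sub: "cone_union \<beta> b X \<union> cone \<beta> b c j \<subseteq> cone_union \<beta> b (insert j X)"
    using c by (auto simp: cone_union_def cone_def)
  have cone: "measure \<nu> (cone \<beta> b c j) = cone_exponent \<beta> * ln (c / b)" "emeasure \<nu> (cone \<beta> b c j) < \<infinity>"
    using emeasure_cone[of r b c \<beta> j] r b \<beta> c cone_exponent_nonneg[of \<beta>]
    by (auto simp: cone_exponent_def measure_def)
  have "measure \<nu> (cone_union \<beta> b X) + cone_exponent \<beta> * ln (c / b)
      = measure \<nu> (cone_union \<beta> b X \<union> cone \<beta> b c j)"
    unfolding cone(1)[symmetric] using cone_union_finite[OF X] cone(2) X disj
    by (intro measure_Union[symmetric]) auto
  also have "\<dots> \<le> measure \<nu> (cone_union \<beta> b (insert j X))"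
    using X cone_union_finite[of "insert j X"]
    by (intro measure_mono_fmeasurable sub fmeasurableI) auto
  finally have "prob (unhit \<beta> b (insert j X)) \<le> exp (- (measure \<nu> (cone_union \<beta> b X) + cone_exponent \<beta> * ln (c / b)))"
    using X by (simp add: prob_unhit)
  also have "\<dots> = prob (unhit \<beta> b X) * exp (- (cone_exponent \<beta> * ln (c / b)))"
    using X by (simp add: prob_unhit exp_diff exp_minus field_simps)
  also have "exp (- (cone_exponent \<beta> * ln (c / b))) = decay \<beta> b t"
    unfolding decay_def c_def[symmetric] using b c by (simp add: powr_def ln_div algebra_simps)
  finally show ?thesis .
qed

text \<open>The identity can fail where a hit set is infinite, because its \<open>card\<close> is
  then 0; this is a null event.\<close>

lemma unhit_insert_AE:
  assumes "finite X"
  shows "AE \<omega> in M. indicator (unhit \<beta> b X) \<omega> * indicator (unhit \<beta> b {j}) \<omega> = (indicator (unhit \<beta> b (insert j X)) \<omega> :: real)"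
proof -
  have "AE \<omega> in M. finite (Y \<omega> \<inter> cone_union \<beta> b X) \<and> finite (Y \<omega> \<inter> cone_union \<beta> b {j})"
    using AE_finite[OF assms] AE_finite[of "{j}"] by simp
  then show ?thesis
  proof (rule eventually_mono)
    fix \<omega> assume fin: "finite (Y \<omega> \<inter> cone_union \<beta> b X) \<and> finite (Y \<omega> \<inter> cone_union \<beta> b {j})"
    have eq: "Y \<omega> \<inter> cone_union \<beta> b (insert j X) = (Y \<omega> \<inter> cone_union \<beta> b X) \<union> (Y \<omega> \<inter> cone_union \<beta> b {j})"
      by (auto simp: cone_union_def)
    have "\<omega> \<in> unhit \<beta> b (insert j X) \<longleftrightarrow> \<omega> \<in> unhit \<beta> b X \<and> \<omega> \<in> unhit \<beta> b {j}"
      unfolding unhit_def using fin eq by auto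
    then show "indicator (unhit \<beta> b X) \<omega> * indicator (unhit \<beta> b {j}) \<omega> = (indicator (unhit \<beta> b (insert j X)) \<omega> :: real)"
      by (auto simp: indicator_def)
  qed
qed

text \<open>Carrying the event that \<open>X\<close> survives makes induction on \<open>k\<close>
  possible: one factor of the power is expanded and its point \<open>j\<close> joins
  \<open>X\<close>. A step costs at most \<open>card X * H\<close>, or \<open>H\<close> for empty
  \<open>X\<close>, and \<open>q + k\<close> dominates these counts throughout since
  \<open>Suc q + k = q + Suc k\<close>.\<close>

lemma moment_bound:
  assumes J: "finite J" and H: "real (card J) * b powr cone_exponent \<beta> \<le> H"
    "\<And>x. x \<in> J \<Longrightarrow> (\<Sum>j\<in>J. decay \<beta> b (dist j x)) \<le> H"
  shows "X \<subseteq> J \<Longrightarrow> card X \<le> q \<Longrightarrow>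
    expectation (\<lambda>\<omega>. indicator (unhit \<beta> b X) \<omega> * (\<Sum>j\<in>J. indicator (unhit \<beta> b {j}) \<omega>) ^ k)
      \<le> prob (unhit \<beta> b X) * (real (q + k) * H) ^ k"
proof (induction k arbitrary: X q)
  case 0
  then have "finite X" using J finite_subset by blast
  then show ?case by simp
next
  case (Suc k)
  let ?S = "\<lambda>\<omega>. \<Sum>j\<in>J. indicator (unhit \<beta> b {j}) \<omega> :: real"
  let ?D = "\<lambda>X \<omega>. indicator (unhit \<beta> b X) \<omega> :: real"
  have X: "finite X" using J Suc.prems finite_subset by blast
  have S: "0 \<le> ?S \<omega>" "?S \<omega> \<le> real (card J)" for \<omega>
    using sum_mono[of J "\<lambda>j. ?D {j} \<omega>" "\<lambda>_. 1"] by (auto intro!: sum_nonneg simp: indicator_def)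
  have int: "integrable M (\<lambda>\<omega>. ?D Z \<omega> * ?S \<omega> ^ k)" if "finite Z" for Z
  proof (rule integrable_const_bound[where B = "real (card J) ^ k"])
    show "AE \<omega> in M. norm (?D Z \<omega> * ?S \<omega> ^ k) \<le> real (card J) ^ k"
      using S by (intro AE_I2) (auto simp: indicator_def power_mono)
  qed (use that J in measurable)
  have H0: "0 \<le> H" using H(1) by (meson mult_nonneg_nonneg of_nat_0_le_iff powr_ge_zero order.trans)
  have "expectation (\<lambda>\<omega>. ?D X \<omega> * ?S \<omega> ^ Suc k) = expectation (\<lambda>\<omega>. \<Sum>j\<in>J. ?D (insert j X) \<omega> * ?S \<omega> ^ k)"
  proof (rule integral_cong_AE)
    have "AE \<omega> in M. \<forall>j\<in>J. ?D X \<omega> * ?D {j} \<omega> = ?D (insert j X) \<omega>"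
      using unhit_insert_AE[OF X] J by (intro AE_finite_allI) auto
    then show "AE \<omega> in M. ?D X \<omega> * ?S \<omega> ^ Suc k = (\<Sum>j\<in>J. ?D (insert j X) \<omega> * ?S \<omega> ^ k)"
    proof (rule eventually_mono)
      fix \<omega> assume *: "\<forall>j\<in>J. ?D X \<omega> * ?D {j} \<omega> = ?D (insert j X) \<omega>"
      have "?D X \<omega> * ?S \<omega> ^ Suc k = (\<Sum>j\<in>J. ?D X \<omega> * ?D {j} \<omega> * ?S \<omega> ^ k)"
        by (simp add: sum_distrib_left sum_distrib_right mult.assoc)
      also have "\<dots> = (\<Sum>j\<in>J. ?D (insert j X) \<omega> * ?S \<omega> ^ k)" using * by (intro sum.cong) auto
      finally show "?D X \<omega> * ?S \<omega> ^ Suc k = (\<Sum>j\<in>J. ?D (insert j X) \<omega> * ?S \<omega> ^ k)" .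
    qed
    show "(\<lambda>\<omega>. ?D X \<omega> * ?S \<omega> ^ Suc k) \<in> borel_measurable M" using X J by measurable
    show "(\<lambda>\<omega>. \<Sum>j\<in>J. ?D (insert j X) \<omega> * ?S \<omega> ^ k) \<in> borel_measurable M"
      by (intro borel_measurable_sum borel_measurable_times borel_measurable_power
          borel_measurable_indicator unhit_sets) (use X in auto)
  qed
  also have "\<dots> = (\<Sum>j\<in>J. expectation (\<lambda>\<omega>. ?D (insert j X) \<omega> * ?S \<omega> ^ k))"
    using X int by (intro Bochner_Integration.integral_sum) auto
  also have "\<dots> \<le> (\<Sum>j\<in>J. prob (unhit \<beta> b (insert j X)) * (real (Suc q + k) * H) ^ k)"
  proof (intro sum_mono Suc.IH)
    fix j assume "j \<in> J"
    then show "insert j X \<subseteq> J" using Suc.prems by simp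
    show "card (insert j X) \<le> Suc q" using Suc.prems X by (simp add: card_insert_if)
  qed
  also have "\<dots> = (\<Sum>j\<in>J. prob (unhit \<beta> b (insert j X))) * (real (Suc q + k) * H) ^ k"
    by (simp add: sum_distrib_right)
  also have "\<dots> \<le> (prob (unhit \<beta> b X) * (real (Suc q + k) * H)) * (real (Suc q + k) * H) ^ k"
  proof (rule mult_right_mono)
    show "(\<Sum>j\<in>J. prob (unhit \<beta> b (insert j X))) \<le> prob (unhit \<beta> b X) * (real (Suc q + k) * H)"
    proof (cases "X = {}")
      case True
      \<comment> \<open>For empty \<open>X\<close> the distance condition is vacuous, so
        \<open>t = 1\<close> is allowed and the decay is the survival probability of one
        point.\<close>
      have "(\<Sum>j\<in>J. prob (unhit \<beta> b (insert j X))) \<le> (\<Sum>j\<in>J. prob (unhit \<beta> b X) * decay \<beta> b 1)"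
        using True by (intro sum_mono prob_unhit_insert X) auto
      also have "\<dots> = prob (unhit \<beta> b X) * (real (card J) * b powr cone_exponent \<beta>)"
        using b by (simp add: decay_def)
      also have "\<dots> \<le> prob (unhit \<beta> b X) * (1 * H)" using H(1) by (intro mult_left_mono) auto
      also have "\<dots> \<le> prob (unhit \<beta> b X) * (real (Suc q + k) * H)"
        using H0 by (intro mult_left_mono mult_right_mono) auto
      finally show ?thesis .
    next
      case False
      \<comment> \<open>The decay at the point of \<open>X\<close> nearest to \<open>j\<close> is at
        most the sum over all of \<open>X\<close>; this removes the dependence of the nearest point
        on \<open>j\<close>, and the two sums can be exchanged.\<close>
      have "(\<Sum>j\<in>J. prob (unhit \<beta> b (insert j X))) \<le> (\<Sum>j\<in>J. prob (unhit \<beta> b X) * (\<Sum>x\<in>X. decay \<beta> b (dist j x)))"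
      proof (rule sum_mono)
        fix j assume "j \<in> J"
        obtain y where y: "y \<in> X" "\<And>x. x \<in> X \<Longrightarrow> dist j y \<le> dist j x"
          using ex_is_arg_min_if_finite[OF X False, of "dist j"] by (auto simp: is_arg_min_linorder)
        have "prob (unhit \<beta> b (insert j X)) \<le> prob (unhit \<beta> b X) * decay \<beta> b (dist j y)"
          using y(2) by (intro prob_unhit_insert X) auto
        also have "\<dots> \<le> prob (unhit \<beta> b X) * (\<Sum>x\<in>X. decay \<beta> b (dist j x))"
          using y(1) X by (intro mult_left_mono member_le_sum decay_nonneg) auto
        finally show "prob (unhit \<beta> b (insert j X)) \<le> prob (unhit \<beta> b X) * (\<Sum>x\<in>X. decay \<beta> b (dist j x))" .
      qed
      also have "\<dots> = prob (unhit \<beta> b X) * (\<Sum>x\<in>X. \<Sum>j\<in>J. decay \<beta> b (dist j x))"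
        by (subst sum.swap) (simp add: sum_distrib_left)
      also have "\<dots> \<le> prob (unhit \<beta> b X) * (\<Sum>x\<in>X. H)"
        using H(2) Suc.prems(1) by (intro mult_left_mono sum_mono) auto
      also have "\<dots> = prob (unhit \<beta> b X) * (real (card X) * H)" by simp
      also have "\<dots> \<le> prob (unhit \<beta> b X) * (real (Suc q + k) * H)"
        using H0 Suc.prems(2) by (intro mult_left_mono mult_right_mono) auto
      finally show ?thesis .
    qed
  qed (use H0 in simp)
  also have "\<dots> = prob (unhit \<beta> b X) * (real (q + Suc k) * H) ^ Suc k" by simp
  finally show ?case .
qed

text \<open>Markov's inequality for the \<open>k\<close>-th power, with \<open>moment_bound\<close>
  started at \<open>X = {}\<close> and \<open>q = 0\<close>.\<close>

lemma survivor_tail: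
  assumes J: "finite J" and H: "real (card J) * b powr cone_exponent \<beta> \<le> H"
    "\<And>x. x \<in> J \<Longrightarrow> (\<Sum>j\<in>J. decay \<beta> b (dist j x)) \<le> H" and c: "0 < c"
  shows "prob {\<omega>\<in>space M. c \<le> (\<Sum>j\<in>J. indicator (unhit \<beta> b {j}) \<omega>)} \<le> (real k * H / c) ^ k"
proof -
  let ?S = "\<lambda>\<omega>. \<Sum>j\<in>J. indicator (unhit \<beta> b {j}) \<omega> :: real"
  have S: "0 \<le> ?S \<omega>" "?S \<omega> \<le> real (card J)" for \<omega>
    using sum_mono[of J "\<lambda>j. indicator (unhit \<beta> b {j}) \<omega> :: real" "\<lambda>_. 1"]
    by (auto intro!: sum_nonneg simp: indicator_def)
  have int: "integrable M (\<lambda>\<omega>. ?S \<omega> ^ k)"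
  proof (rule integrable_const_bound[where B = "real (card J) ^ k"])
    show "AE \<omega> in M. norm (?S \<omega> ^ k) \<le> real (card J) ^ k"
      using S by (intro AE_I2) (auto simp: power_mono)
  qed (use J in measurable)
  have univ: "unhit \<beta> b {} = space M" by (auto simp: unhit_def cone_union_def)
  have "prob {\<omega>\<in>space M. c \<le> ?S \<omega>} \<le> prob {\<omega>\<in>space M. ?S \<omega> ^ k \<ge> c ^ k}"
  proof (rule finite_measure_mono)
    show "{\<omega>\<in>space M. ?S \<omega> ^ k \<ge> c ^ k} \<in> sets M" using J by measurable
    show "{\<omega> \<in> space M. c \<le> ?S \<omega>} \<subseteq> {\<omega>\<in>space M. ?S \<omega> ^ k \<ge> c ^ k}"
      using c by (auto intro: power_mono)
  qed
  also have "\<dots> \<le> expectation (\<lambda>\<omega>. ?S \<omega> ^ k) / c ^ k"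
    using int c S by (intro integral_Markov_inequality_measure[where A = "space M"]) auto
  also have "expectation (\<lambda>\<omega>. ?S \<omega> ^ k) = expectation (\<lambda>\<omega>. indicator (unhit \<beta> b {}) \<omega> * ?S \<omega> ^ k)"
    unfolding univ by (intro Bochner_Integration.integral_cong) auto
  also have "\<dots> \<le> prob (unhit \<beta> b {}) * (real (0 + k) * H) ^ k"
    by (rule moment_bound[OF J H]) auto
  finally show ?thesis using c univ prob_space by (simp add: power_divide divide_right_mono)
qed

end

end

section \<open>Box dimension of the intersections\<close>

lemma summable_poly_geometric: "summable (\<lambda>n. (real n + 1) ^ k * (1 / 2) ^ n)"
proof -
  have "(\<lambda>n. ((real n + 2) / (real n + 1)) ^ k * (1 / 2)) \<longlonglongrightarrow> 1 ^ k * (1 / 2)"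
  proof (intro tendsto_intros)
    have "(\<lambda>n. (real n + 2) / (real n + 1)) = (\<lambda>n. 1 + inverse (real (Suc n)))"
      by (auto simp: fun_eq_iff field_simps)
    moreover have "(\<lambda>n. 1 + inverse (real (Suc n))) \<longlonglongrightarrow> 1 + 0"
      by (intro tendsto_intros LIMSEQ_inverse_real_of_nat)
    ultimately show "(\<lambda>n. (real n + 2) / (real n + 1)) \<longlonglongrightarrow> 1" by simp
  qed
  then have "\<forall>\<^sub>F n in sequentially. ((real n + 2) / (real n + 1)) ^ k * (1 / 2) < 3 / 4"
    by (rule order_tendstoD) simp
  then obtain N where "\<forall>n\<ge>N. ((real n + 2) / (real n + 1)) ^ k * (1 / 2) < 3 / 4"
    unfolding eventually_sequentially by (rule exE)
  note N = this[rule_format]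
  show ?thesis
  proof (rule summable_ratio_test[of "3 / 4" N])
    fix n assume "N \<le> n"
    have "(real (Suc n) + 1) ^ k * (1 / 2) ^ Suc n
        = (((real n + 2) / (real n + 1)) ^ k * (1 / 2)) * ((real n + 1) ^ k * (1 / 2) ^ n)"
      by (simp add: power_divide field_simps)
    also have "\<dots> \<le> (3 / 4) * ((real n + 1) ^ k * (1 / 2) ^ n)"
      using N[OF \<open>N \<le> n\<close>] by (intro mult_right_mono) auto
    finally show "norm ((real (Suc n) + 1) ^ k * (1 / 2) ^ Suc n) \<le> 3 / 4 * norm ((real n + 1) ^ k * (1 / 2) ^ n)"
      by simp
  qed simp
qed

section \<open>From regular nets and moments to covers of the intersections\<close>

context ball_cutout
begin

text \<open>Dyadic layers turn a sum of decays over net points into counts of net points in balls.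
  The first term serves \<open>t >= 1\<close>; otherwise the least \<open>l\<close> with
  \<open>t < 2 ^ Suc l * (1 / 2) ^ n\<close> alone suffices, and it is at most
  \<open>n\<close>.\<close>

lemma decay_le_dyadic:
  assumes "0 \<le> \<beta>" "0 \<le> t"
  shows "decay \<beta> ((1 / 2) ^ n) t \<le> ((1 / 2) ^ n) powr cone_exponent \<beta> +
    (\<Sum>l\<le>n. if t < 2 ^ Suc l * (1 / 2) ^ n then ((1 / 2) ^ l) powr cone_exponent \<beta> else 0)"
proof -
  let ?b = "(1 / 2 :: real) ^ n" and ?a = "cone_exponent \<beta>"
  let ?g = "\<lambda>l. if t < 2 ^ Suc l * ?b then ((1 / 2 :: real) ^ l) powr ?a else 0"
  have a: "0 \<le> ?a" using cone_exponent_nonneg[OF assms(1)] .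
  have b: "0 < ?b" "?b \<le> 1" by (auto intro: power_le_one)
  have dec: "decay \<beta> ?b t \<le> u powr ?a" if "?b / max ?b (min t 1) \<le> u" for u
    unfolding decay_def using that a b by (intro powr_mono2) (auto simp: le_max_iff_disj)
  have sum: "?g l \<le> (\<Sum>l\<le>n. ?g l)" if "l \<le> n" for l
    using that by (intro member_le_sum) auto
  show ?thesis
  proof (cases "t < 1")
    case False
    then have "decay \<beta> ?b t \<le> ?b powr ?a" using b by (intro dec) simp
    then show ?thesis by (intro order.trans[OF _ add_increasing2]) (auto intro!: sum_nonneg)
  next
    case True
    define l where "l = (LEAST l. t < 2 ^ Suc l * ?b)"
    have n: "t < 2 ^ Suc n * ?b" using True by (simp add: power_one_over)
    have l: "t < 2 ^ Suc l * ?b" "l \<le> n"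
      unfolding l_def using n by (rule LeastI, rule Least_le)
    have "?b / max ?b (min t 1) \<le> (1 / 2) ^ l"
    proof (cases l)
      case 0
      then show ?thesis using b by (simp add: divide_le_eq_1 less_max_iff_disj)
    next
      case (Suc l')
      have "\<not> t < 2 ^ Suc l' * ?b" using not_less_Least[of l' "\<lambda>l. t < 2 ^ Suc l * ?b"] Suc l_def by simp
      then have "2 ^ l * ?b \<le> t" using Suc by simp
      then have "2 ^ l * ?b \<le> max ?b (min t 1)" using True by simp
      then have "?b / max ?b (min t 1) \<le> ?b / (2 ^ l * ?b)" using b by (intro divide_left_mono) (auto simp: less_max_iff_disj)
      then show ?thesis using b by (simp add: power_one_over)
    qed
    then have "decay \<beta> ?b t \<le> ?g l" using dec l(1) by simp
    also have "\<dots> \<le> (\<Sum>l\<le>n. ?g l)" by (rule sum[OF l(2)])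
    finally show ?thesis by (simp add: add_increasing)
  qed
qed

text \<open>Write a for the cone exponent. Layer \<open>l\<close> holds at most a constant times
  \<open>2 powr (l * s)\<close> points of weight \<open>2 powr (- l * a)\<close>. As s >= a, each of
  the n + 1 layers is bounded by the last one, at the price of the factor \<open>n + 1\<close>; this
  includes s = a.\<close>

lemma sum_decay_le:
  assumes \<beta>: "0 \<le> \<beta>" and s: "cone_exponent \<beta> \<le> s" and C: "0 \<le> C" and P: "finite P"
    and loc: "\<And>\<rho>. (1 / 2) ^ n \<le> \<rho> \<Longrightarrow> real (card (P \<inter> ball x \<rho>)) \<le> C * (\<rho> / (1 / 2) ^ n) powr s"
    and tot: "real (card P) \<le> C * (2 ^ n) powr s"
  shows "(\<Sum>p\<in>P. decay \<beta> ((1 / 2) ^ n) (dist p x)) \<le> C * (1 + 2 powr s) * (real n + 1) * 2 powr (real n * (s - cone_exponent \<beta>))"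
    and "real (card P) * ((1 / 2) ^ n) powr cone_exponent \<beta> \<le> C * (1 + 2 powr s) * (real n + 1) * 2 powr (real n * (s - cone_exponent \<beta>))"
proof -
  let ?b = "(1 / 2 :: real) ^ n" and ?a = "cone_exponent \<beta>"
  let ?Z = "2 powr (real n * (s - ?a))"
  have pw: "(2 ^ l) powr s * ((1 / 2) ^ l) powr ?a = 2 powr (real l * (s - ?a))" for l :: nat
    by (simp add: powr_realpow[symmetric] powr_powr power_one_over powr_minus_divide[symmetric] powr_add[symmetric]
        algebra_simps powr_diff flip: powr_minus)
  have 1: "real (card P) * ?b powr ?a \<le> C * ?Z"
    using mult_right_mono[OF tot, of "?b powr ?a"] pw[of n] by (simp add: mult.assoc)
  have C1: "C * ?Z \<le> C * (1 + 2 powr s) * (real n + 1) * ?Z"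
  proof -
    have "1 * 1 \<le> (1 + 2 powr s) * (real n + 1)" by (intro mult_mono) auto
    then have "C * 1 \<le> C * ((1 + 2 powr s) * (real n + 1))" using C by (intro mult_left_mono) auto
    then show ?thesis by (intro mult_right_mono) (auto simp: mult.assoc)
  qed
  show "real (card P) * ?b powr ?a \<le> C * (1 + 2 powr s) * (real n + 1) * ?Z"
    using 1 C1 by linarith
  have lev: "(\<Sum>p\<in>P. if dist p x < 2 ^ Suc l * ?b then ((1 / 2) ^ l) powr ?a else 0) \<le> C * 2 powr s * ?Z"
    if l: "l \<le> n" for l
  proof -
    have "(\<Sum>p\<in>P. if dist p x < 2 ^ Suc l * ?b then ((1 / 2) ^ l) powr ?a else 0)
        = real (card (P \<inter> ball x (2 ^ Suc l * ?b))) * ((1 / 2) ^ l) powr ?a"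
      using P by (simp add: sum.If_cases ball_def dist_commute Int_def)
    also have "\<dots> \<le> (C * (2 ^ Suc l * ?b / ?b) powr s) * ((1 / 2) ^ l) powr ?a"
    proof (intro mult_right_mono loc)
      have "1 * ?b \<le> 2 ^ Suc l * ?b" by (intro mult_right_mono one_le_power) auto
      then show "?b \<le> 2 ^ Suc l * ?b" by simp
    qed simp
    also have "(2 ^ Suc l * ?b / ?b) powr s = 2 powr s * (2 ^ l) powr s" by (simp add: powr_mult)
    also have "C * (2 powr s * (2 ^ l) powr s) * ((1 / 2) ^ l) powr ?a = C * 2 powr s * ((2 ^ l) powr s * ((1 / 2) ^ l) powr ?a)"
      by (simp only: mult_ac)
    also have "\<dots> = C * 2 powr s * 2 powr (real l * (s - ?a))" unfolding pw by (rule refl)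
    also have "\<dots> \<le> C * 2 powr s * ?Z"
      using l s C by (intro mult_left_mono powr_mono mult_right_mono) auto
    finally show ?thesis .
  qed
  have "(\<Sum>p\<in>P. decay \<beta> ?b (dist p x))
      \<le> (\<Sum>p\<in>P. ?b powr ?a + (\<Sum>l\<le>n. if dist p x < 2 ^ Suc l * ?b then ((1 / 2) ^ l) powr ?a else 0))"
    by (intro sum_mono decay_le_dyadic \<beta>) simp
  also have "\<dots> = real (card P) * ?b powr ?a + (\<Sum>l\<le>n. \<Sum>p\<in>P. if dist p x < 2 ^ Suc l * ?b then ((1 / 2) ^ l) powr ?a else 0)"
    by (simp add: sum.distrib sum.swap[of _ "{..n}"])
  also have "\<dots> \<le> C * ?Z + (\<Sum>l\<le>n. C * 2 powr s * ?Z)"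
    by (intro add_mono 1 sum_mono lev) auto
  also have "\<dots> = (C * 1 + C * 2 powr s * (real n + 1)) * ?Z" by (simp add: algebra_simps)
  also have "\<dots> \<le> (C * (real n + 1) + C * 2 powr s * (real n + 1)) * ?Z"
    using C by (intro mult_right_mono add_right_mono mult_left_mono) auto
  also have "\<dots> = C * (1 + 2 powr s) * (real n + 1) * ?Z" by (simp add: algebra_simps)
  finally show "(\<Sum>p\<in>P. decay \<beta> ?b (dist p x)) \<le> C * (1 + 2 powr s) * (real n + 1) * ?Z" .
qed

text \<open>Removed balls are open, and an open set disjoint from a set is disjoint from its
  closure; so taking the closure in \<open>cutout_A\<close> does not refill them.\<close>

lemma cutout_A_avoids:
  assumes "z \<in> cutout_A Z" "p \<in> Z" "0 < snd p" "snd p < 1"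
  shows "z \<notin> ball_of p"
proof
  assume z: "z \<in> ball_of p"
  obtain n where n: "(1 / 2) ^ n < snd p" using real_arch_pow_inv[of "snd p" "1 / 2"] assms(3) by auto
  have "ball_of p \<inter> (\<Inter>n. cutout_An Z n) = {}"
  proof -
    have "ball_of p \<subseteq> \<Union> {ball_of p |p. p \<in> Z \<and> (1 / 2) ^ n \<le> snd p \<and> snd p < 1}"
      using assms n by (intro Union_upper CollectI exI[of _ p]) auto
    then have "ball_of p \<inter> cutout_An Z n = {}" unfolding cutout_An_def by blast
    then show ?thesis by blast
  qed
  moreover have "open (ball_of p)" by (simp add: ball_of_def)
  ultimately have "ball_of p \<inter> closure (\<Inter>n. cutout_An Z n) = {}"
    using open_Int_closure_eq_empty by blast
  then show False using z assms(1) unfolding cutout_A_def by blast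
qed

text \<open>The slack (1/2 - \<beta>) s between the two radii grows with the scale, so the condition
  at the smallest scale \<open>b\<close> transfers survival from \<open>z\<close> to
  \<open>p\<close> at all scales.\<close>

lemma survivor_unhit:
  assumes z: "z \<in> cutout_A (Y \<omega>)" "dist p z < 2 * a" and a: "2 * a \<le> (1 / 2 - \<beta>) * b"
    and \<beta>: "\<beta> \<le> 1 / 2" and b: "0 < b" and \<omega>: "\<omega> \<in> space M"
  shows "\<omega> \<in> unhit \<beta> b {p}"
proof -
  have "q \<notin> Y \<omega>" if "q \<in> cone \<beta> b 1 p" for q
  proof
    assume q: "q \<in> Y \<omega>"
    have c: "b \<le> snd q" "snd q < 1" "dist p (snd q *\<^sub>R fst q) < \<beta> * snd q" using that by (auto simp: cone_def)
    have "dist (snd q *\<^sub>R fst q) z \<le> dist p (snd q *\<^sub>R fst q) + dist p z" by (rule dist_triangle3)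
    also have "\<dots> < \<beta> * snd q + (1 / 2 - \<beta>) * b" using c(3) z(2) a by linarith
    also have "\<dots> \<le> \<beta> * snd q + (1 / 2 - \<beta>) * snd q" using c(1) \<beta> by (intro add_left_mono mult_left_mono) auto
    also have "\<dots> = snd q / 2" by (simp add: algebra_simps)
    finally have "z \<in> ball_of q" by (simp add: ball_of_def)
    then show False using cutout_A_avoids[OF z(1) q] c b by simp
  qed
  then have "Y \<omega> \<inter> cone_union \<beta> b {p} = {}" by (auto simp: cone_union_def)
  then show ?thesis using \<omega> by (simp add: unhit_def)
qed

text \<open>Witness form of an upper bound on \<open>covering_number\<close>: it asserts that a
  cover exists, and the bound is real, so that powers of 2 can be used directly.\<close>

definition small_cover :: "'a set \<Rightarrow> real \<Rightarrow> real \<Rightarrow> bool" where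
  "small_cover S \<delta> N \<longleftrightarrow> (\<exists>C. finite C \<and> S \<subseteq> \<Union>C \<and> (\<forall>U\<in>C. bounded U \<and> diameter U \<le> \<delta>) \<and> real (card C) \<le> N)"

text \<open>The quantifier over \<open>E\<close> stands inside \<open>AE\<close>: the bad events
  refer to the finitely many sets in \<open>F n\<close>, and an arbitrary \<open>E\<close> is
  treated through the surviving net points of a close \<open>E'\<close>.\<close>

lemma AE_small_cover:
  assumes K: "1 \<le> K" and \<beta>: "0 \<le> \<beta>" "\<beta> < 1 / 2" and s: "0 \<le> s" "cone_exponent \<beta> \<le> s" and \<epsilon>: "0 < \<epsilon>"
  shows "AE \<omega> in M. \<forall>E. ss_class m K s E \<longrightarrow> (\<forall>\<^sub>F n in sequentially.
     small_cover (E \<inter> cutout_A (Y \<omega>)) ((1 / 2) ^ n) (2 powr (real n * (s - cone_exponent \<beta> + \<epsilon>))))"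
proof -
  \<comment> \<open>Dividing \<open>b\<close> by \<open>\<Lambda>\<close> gives exactly
    \<open>2 * a n = (1 / 2 - \<beta>) * b\<close>, the condition of \<open>survivor_unhit\<close>;
    \<open>4 <= \<Lambda>\<close> makes balls of radius \<open>2 * a n\<close> small enough for the
    cover. One \<open>a n\<close> leads from \<open>E\<close> to \<open>E'\<close>, the other from
    \<open>E'\<close> to its net.\<close>
  define \<Lambda> where "\<Lambda> = 4 / (1 - 2 * \<beta>)"
  have \<Lambda>: "4 \<le> \<Lambda>" using \<beta> by (simp add: \<Lambda>_def field_simps)
  let ?b = "\<lambda>n. (1 / 2 :: real) ^ n"
  have b: "0 < ?b n" "?b n \<le> 1" for n by (auto intro: power_le_one)
  define a where "a n = ?b n / \<Lambda>" for n
  have a: "0 < a n" "a n \<le> 1" "4 * a n \<le> ?b n" "2 * a n \<le> (1 / 2 - \<beta>) * ?b n" for n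
  proof -
    show "0 < a n" using \<Lambda> by (simp add: a_def)
    have "4 * ?b n \<le> \<Lambda> * ?b n" using \<Lambda> by (intro mult_right_mono) auto
    then show "4 * a n \<le> ?b n" using \<Lambda> by (simp add: a_def field_simps)
    then show "a n \<le> 1" using b[of n] by linarith
    show "2 * a n \<le> (1 / 2 - \<beta>) * ?b n" using \<beta> by (simp add: a_def \<Lambda>_def field_simps)
  qed
  obtain A L where AL: "\<forall>\<delta>. 0 < \<delta> \<longrightarrow> \<delta> \<le> 1 \<longrightarrow> (\<exists>F. finite F \<and> (\<forall>E\<in>F. ss_class m K s E) \<and>
     real (card F) \<le> A * (1 / \<delta>) ^ L \<and>
     (\<forall>E :: 'a set. ss_class m K s E \<longrightarrow> (\<exists>E'\<in>F. \<forall>x\<in>E. \<exists>y\<in>E'. dist x y \<le> \<delta>)))"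
    using ss_class_net[OF K, of m s] by (elim exE)
  have "\<forall>n. \<exists>F. finite F \<and> (\<forall>E\<in>F. ss_class m K s E) \<and> real (card F) \<le> A * (1 / a n) ^ L \<and>
     (\<forall>E :: 'a set. ss_class m K s E \<longrightarrow> (\<exists>E'\<in>F. \<forall>x\<in>E. \<exists>y\<in>E'. dist x y \<le> a n))"
    using AL a(1,2) by simp
  from choice[OF this] obtain F where F': "\<forall>n. finite (F n) \<and> (\<forall>E\<in>F n. ss_class m K s E) \<and> real (card (F n)) \<le> A * (1 / a n) ^ L \<and>
     (\<forall>E :: 'a set. ss_class m K s E \<longrightarrow> (\<exists>E'\<in>F n. \<forall>x\<in>E. \<exists>y\<in>E'. dist x y \<le> a n))" by (rule exE)
  then have F: "finite (F n)" "\<And>E. E \<in> F n \<Longrightarrow> ss_class m K s E" "real (card (F n)) \<le> A * (1 / a n) ^ L"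
    "\<And>E. ss_class m K s E \<Longrightarrow> \<exists>E'\<in>F n. \<forall>x\<in>E. \<exists>y\<in>E'. dist x y \<le> a n" for n by simp_all
  have ball: "E \<subseteq> ball 0 (K + 1)" if "ss_class m K s E" for E :: "'a set"
    using that unfolding ss_class_def by auto
  have ass: "assouad_bound K s E" if "ss_class m K s E" for E :: "'a set"
    using that unfolding ss_class_def by simp
  have "\<forall>n. \<forall>E :: 'a set. \<exists>P. ss_class m K s E \<longrightarrow> finite P \<and> P \<subseteq> E \<and> separated (a n) P \<and> E \<subseteq> (\<Union>p\<in>P. ball p (a n))"
  proof (intro allI)
    fix n and E :: "'a set"
    show "\<exists>P. ss_class m K s E \<longrightarrow> finite P \<and> P \<subseteq> E \<and> separated (a n) P \<and> E \<subseteq> (\<Union>p\<in>P. ball p (a n))"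
    proof (cases "ss_class m K s E")
      case True
      have "a n \<le> 2 * (K + 1)" using order.trans[OF a(2)[of n], of "2 * (K + 1)"] K by simp
      from maximal_separated[OF ass[OF True] ball[OF True] a(1) this] show ?thesis by metis
    qed simp
  qed
  then obtain P where "\<forall>n. \<forall>E :: 'a set. ss_class m K s E \<longrightarrow> finite (P n E) \<and> P n E \<subseteq> E \<and> separated (a n) (P n E) \<and> E \<subseteq> (\<Union>p\<in>P n E. ball p (a n))"
    by metis
  then have P: "finite (P n E)" "P n E \<subseteq> E" "separated (a n) (P n E)" "E \<subseteq> (\<Union>p\<in>P n E. ball p (a n))"
    if "ss_class m K s E" for n E using that by simp_all
  \<comment> \<open>\<open>2 * \<Lambda>\<close> accounts for separation at \<open>a n\<close>
    instead of \<open>b\<close>; with \<open>K + 1\<close> the same constant serves the total count,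
    taken in \<open>ball 0 (K + 1)\<close>.\<close>
  define C where "C = K * (2 * \<Lambda> * (K + 1)) powr s"
  have C: "0 \<le> C" using K by (simp add: C_def)
  have loc: "real (card (P n E \<inter> ball x \<rho>)) \<le> K * (2 * \<Lambda> * (\<rho> / ?b n)) powr s"
    if E: "ss_class m K s E" and \<rho>: "?b n \<le> \<rho>" for n E x \<rho>
  proof -
    have "separated (a n) (P n E \<inter> ball x \<rho>)" using P(3)[OF E] by (auto simp: separated_def)
    moreover have "P n E \<inter> ball x \<rho> \<subseteq> E \<inter> ball x \<rho>" using P(2)[OF E] by blast
    moreover have "a n \<le> 2 * \<rho>" using a(3)[of n] \<rho> b[of n] a(1)[of n] by linarith
    ultimately have "real (card (P n E \<inter> ball x \<rho>)) \<le> K * (2 * \<rho> / a n) powr s"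
      using card_separated_le[OF ass[OF E] _ _ a(1)] by blast
    then show ?thesis using \<Lambda> by (simp add: a_def mult_ac)
  qed
  have loc': "real (card (P n E \<inter> ball x \<rho>)) \<le> C * (\<rho> / ?b n) powr s"
    if E: "ss_class m K s E" and \<rho>: "?b n \<le> \<rho>" for n E x \<rho>
  proof -
    have \<rho>0: "0 \<le> \<rho> / ?b n" using \<rho> b[of n] by (intro divide_nonneg_nonneg) linarith+
    have "(2 * \<Lambda>) * (\<rho> / ?b n) \<le> (2 * \<Lambda> * (K + 1)) * (\<rho> / ?b n)"
      using \<Lambda> K \<rho>0 by (intro mult_right_mono) auto
    then have "K * (2 * \<Lambda> * (\<rho> / ?b n)) powr s \<le> K * ((2 * \<Lambda> * (K + 1)) * (\<rho> / ?b n)) powr s"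
      using K s \<Lambda> mult_nonneg_nonneg[of "2 * \<Lambda>" "\<rho> / ?b n", OF _ \<rho>0] by (intro mult_left_mono powr_mono2) auto
    also have "\<dots> = C * (\<rho> / ?b n) powr s"
      using \<Lambda> K \<rho>0 by (subst powr_mult) (auto simp: C_def)
    finally show ?thesis using loc[OF E \<rho>, of x] by linarith
  qed
  have tot: "real (card (P n E)) \<le> C * (2 ^ n) powr s" if E: "ss_class m K s E" for n E
  proof -
    have "P n E \<inter> ball 0 (K + 1) = P n E" using P(2)[OF E] ball[OF E] by blast
    moreover have "?b n \<le> K + 1" using b[of n] K by linarith
    ultimately have "real (card (P n E)) \<le> K * (2 * \<Lambda> * ((K + 1) / ?b n)) powr s"
      using loc[OF E, of n "K + 1" 0] by simp
    also have "2 * \<Lambda> * ((K + 1) / ?b n) = (2 * \<Lambda> * (K + 1)) * 2 ^ n" by (simp add: power_one_over)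
    also have "K * \<dots> powr s = C * (2 ^ n) powr s" using \<Lambda> K by (subst powr_mult) (auto simp: C_def)
    finally show ?thesis .
  qed
  define B where "B = C * (1 + 2 powr s)"
  have B: "0 \<le> B" using C by (simp add: B_def)
  define c where "c n = 2 powr (real n * (s - cone_exponent \<beta> + \<epsilon>))" for n :: nat
  define S where "S n E \<omega> = (\<Sum>p\<in>P n E. indicator (unhit \<beta> (?b n) {p}) \<omega> :: real)" for n E \<omega>
  \<comment> \<open>With \<open>\<epsilon> * k >= L + 1\<close> the tail is
    \<open>2 powr (- n * (L + 1))\<close> up to polynomial factors: \<open>L\<close> powers pay for
    the size of \<open>F n\<close>, and the last one makes the sum over \<open>n\<close>
    converge.\<close>
  obtain k :: nat where k: "(real L + 1) / \<epsilon> \<le> real k" using real_arch_simple by blast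
  have k': "real L + 1 \<le> \<epsilon> * real k" using k \<epsilon> by (simp add: field_simps)
  define bad where "bad n = (\<Union>E\<in>F n. {\<omega>\<in>space M. c n \<le> S n E \<omega>})" for n
  have S_meas: "S n E \<in> borel_measurable M" for n E
    unfolding S_def[abs_def] using \<beta> b
    by (intro borel_measurable_sum borel_measurable_indicator unhit_sets) auto
  have bad_sets: "bad n \<in> sets M" for n
    unfolding bad_def using S_meas F(1) by (intro sets.finite_UN) (auto intro!: borel_measurable_le)
  have one: "prob {\<omega>\<in>space M. c n \<le> S n E \<omega>} \<le> (real k * B) ^ k * (real n + 1) ^ k * (1 / 2) ^ n / (2 ^ n) ^ L"
    if E: "ss_class m K s E" for n E
  proof -
    let ?H = "B * (real n + 1) * 2 powr (real n * (s - cone_exponent \<beta>))"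
    have "prob {\<omega>\<in>space M. c n \<le> S n E \<omega>} \<le> (real k * ?H / c n) ^ k"
      unfolding S_def
    proof (rule survivor_tail)
      show "real (card (P n E)) * ?b n powr cone_exponent \<beta> \<le> ?H" unfolding B_def
        by (rule sum_decay_le(2)[OF \<beta>(1) s(2) C P(1)[OF E] loc'[OF E] tot[OF E]])
      show "(\<Sum>j\<in>P n E. decay \<beta> (?b n) (dist j x)) \<le> ?H" for x unfolding B_def
        by (rule sum_decay_le(1)[OF \<beta>(1) s(2) C P(1)[OF E] loc'[OF E] tot[OF E]])
    qed (use \<beta> b P(1)[OF E] in \<open>auto simp: c_def\<close>)
    also have "real k * ?H / c n = (real k * B) * (real n + 1) * 2 powr (- (real n * \<epsilon>))"
    proof -
      have "c n = 2 powr (real n * (s - cone_exponent \<beta>)) * 2 powr (real n * \<epsilon>)"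
        by (simp add: c_def distrib_left powr_add)
      then show ?thesis by (simp add: powr_minus divide_simps)
    qed
    also have "(\<dots>) ^ k = (real k * B) ^ k * (real n + 1) ^ k * 2 powr (- (real n * (\<epsilon> * real k)))"
      by (simp add: power_mult_distrib powr_powr mult.assoc flip: powr_realpow)
    also have "\<dots> \<le> (real k * B) ^ k * (real n + 1) ^ k * 2 powr (- (real n * (real L + 1)))"
      using B k' by (intro mult_left_mono powr_mono) (auto intro: mult_left_mono)
    also have "2 powr (- (real n * (real L + 1))) = (1 / 2) ^ n / (2 ^ n) ^ L"
    proof -
      have "2 powr (- (real n * (real L + 1))) = 2 powr (- real n) * 2 powr (- (real n * real L))"
        by (simp add: algebra_simps flip: powr_add)
      also have "2 powr (- real n) = (1 / 2 :: real) ^ n" by (simp add: powr_minus powr_realpow power_one_over inverse_eq_divide)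
      also have "2 powr (- (real n * real L)) = 1 / ((2 :: real) ^ n) ^ L"
        by (simp add: powr_minus inverse_eq_divide flip: powr_powr powr_realpow)
      finally show ?thesis by simp
    qed
    finally show ?thesis by simp
  qed
  have bad_prob: "prob (bad n) \<le> (\<bar>A\<bar> * \<Lambda> ^ L * (real k * B) ^ k) * ((real n + 1) ^ k * (1 / 2) ^ n)" for n
  proof -
    let ?q = "(real k * B) ^ k * (real n + 1) ^ k * (1 / 2) ^ n / (2 ^ n) ^ L"
    have "prob (bad n) \<le> (\<Sum>E\<in>F n. prob {\<omega>\<in>space M. c n \<le> S n E \<omega>})"
      unfolding bad_def using S_meas F(1)
      by (intro measure_UNION_le) (auto intro!: borel_measurable_le)
    also have "\<dots> \<le> (\<Sum>E\<in>F n. ?q)" using F(2) by (intro sum_mono one)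
    also have "\<dots> = real (card (F n)) * ?q" by simp
    also have "\<dots> \<le> (\<bar>A\<bar> * (\<Lambda> * 2 ^ n) ^ L) * ?q"
    proof (rule mult_right_mono)
      have "1 / a n = \<Lambda> * 2 ^ n" by (simp add: a_def power_one_over)
      then have "real (card (F n)) \<le> A * (\<Lambda> * 2 ^ n) ^ L" using F(3)[of n] by simp
      also have "\<dots> \<le> \<bar>A\<bar> * (\<Lambda> * 2 ^ n) ^ L" using \<Lambda> by (intro mult_right_mono) auto
      finally show "real (card (F n)) \<le> \<bar>A\<bar> * (\<Lambda> * 2 ^ n) ^ L" .
    qed (use B in simp)
    also have "\<dots> = (\<bar>A\<bar> * \<Lambda> ^ L * (real k * B) ^ k) * ((real n + 1) ^ k * (1 / 2) ^ n)"
      by (simp add: power_mult_distrib)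
    finally show ?thesis .
  qed
  have "summable (\<lambda>n. prob (bad n))"
  proof (rule summable_comparison_test')
    show "summable (\<lambda>n. (\<bar>A\<bar> * \<Lambda> ^ L * (real k * B) ^ k) * ((real n + 1) ^ k * (1 / 2) ^ n))"
      by (intro summable_mult summable_poly_geometric)
    show "norm (prob (bad n)) \<le> (\<bar>A\<bar> * \<Lambda> ^ L * (real k * B) ^ k) * ((real n + 1) ^ k * (1 / 2) ^ n)" for n
      using bad_prob[of n] by simp
  qed
  then have "AE \<omega> in M. \<forall>\<^sub>F n in sequentially. \<omega> \<in> space M - bad n"
    by (intro borel_cantelli_AE1 bad_sets) (simp_all add: emeasure_eq_measure)
  then show ?thesis
  proof (rule eventually_mono)
    fix \<omega> assume \<omega>: "\<forall>\<^sub>F n in sequentially. \<omega> \<in> space M - bad n"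
    show "\<forall>E. ss_class m K s E \<longrightarrow> (\<forall>\<^sub>F n in sequentially.
       small_cover (E \<inter> cutout_A (Y \<omega>)) (?b n) (2 powr (real n * (s - cone_exponent \<beta> + \<epsilon>))))"
    proof (intro allI impI)
      fix E :: "'a set" assume E: "ss_class m K s E"
      show "\<forall>\<^sub>F n in sequentially.
       small_cover (E \<inter> cutout_A (Y \<omega>)) (?b n) (2 powr (real n * (s - cone_exponent \<beta> + \<epsilon>)))"
        using \<omega>
      proof (rule eventually_mono)
        fix n assume n: "\<omega> \<in> space M - bad n"
        obtain E' where E': "E' \<in> F n" "\<forall>x\<in>E. \<exists>y\<in>E'. dist x y \<le> a n" using F(4)[OF E, of n] by (elim bexE)
        have cl: "ss_class m K s E'" using F(2)[OF E'(1)] .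
        have "S n E' \<omega> < c n" using n E'(1) by (auto simp: bad_def not_le)
        define Q where "Q = {p \<in> P n E'. \<omega> \<in> unhit \<beta> (?b n) {p}}"
        have "S n E' \<omega> = real (card Q)"
          unfolding S_def Q_def indicator_def using P(1)[OF cl] by (simp add: sum.If_cases Int_def)
        then have card: "real (card Q) \<le> c n" using \<open>S n E' \<omega> < c n\<close> by simp
        have finQ: "finite Q" using P(1)[OF cl] by (simp add: Q_def)
        have "E \<inter> cutout_A (Y \<omega>) \<subseteq> \<Union> ((\<lambda>p. ball p (2 * a n)) ` Q)"
        proof
          fix z assume z: "z \<in> E \<inter> cutout_A (Y \<omega>)"
          then obtain y where y: "y \<in> E'" "dist z y \<le> a n" using E'(2) by blast
          then obtain p where p: "p \<in> P n E'" "dist p y < a n" using P(4)[OF cl, of n] by auto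
          have "dist p z < 2 * a n" using dist_triangle2[of p z y] y p by linarith
          moreover from this have "p \<in> Q" unfolding Q_def
            using p z n \<beta> b a(4)[of n] survivor_unhit[of z \<omega> p "a n" \<beta> "?b n"] by simp
          ultimately show "z \<in> \<Union> ((\<lambda>p. ball p (2 * a n)) ` Q)" by auto
        qed
        moreover have "diameter (ball p (2 * a n)) \<le> ?b n" for p :: 'a
        proof -
          have "diameter (ball p (2 * a n)) \<le> 4 * a n"
            using a(1)[of n] by (simp add: diameter_ball)
          then show ?thesis using a(3)[of n] by linarith
        qed
        moreover have "real (card ((\<lambda>p. ball p (2 * a n)) ` Q)) \<le> c n"
          using card card_image_le[OF finQ, of "\<lambda>p. ball p (2 * a n)"] by linarith
        ultimately show "small_cover (E \<inter> cutout_A (Y \<omega>)) (?b n) (2 powr (real n * (s - cone_exponent \<beta> + \<epsilon>)))"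
          unfolding small_cover_def c_def[symmetric] using finQ
          by (intro exI[of _ "(\<lambda>p. ball p (2 * a n)) ` Q"]) auto
      qed
    qed
  qed
qed

text \<open>For general \<delta>, take \<open>n\<close> as L = log 2 (1 / \<delta>) rounded up.
  Rounding adds at most \<open>g\<close> to the exponent L g, and this is below \<open>e * L\<close>
  once \<delta> is small.\<close>

lemma small_cover_upper_box_dim:
  fixes S :: "'a set"
  assumes g: "0 < g" and cov: "\<forall>\<^sub>F n in sequentially. small_cover S ((1 / 2) ^ n) (2 powr (real n * g))"
  shows "upper_box_dim S \<le> ereal g"
proof (cases "S = {}")
  case False
  obtain n0 where n0: "\<And>n. n0 \<le> n \<Longrightarrow> small_cover S ((1 / 2) ^ n) (2 powr (real n * g))"
    using cov unfolding eventually_sequentially by metis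
  have "Limsup (at_right 0) (\<lambda>\<delta>. ereal (ln (real (covering_number S \<delta>)) / - ln \<delta>)) \<le> ereal g + ereal e"
    if e: "0 < e" for e
  proof (rule Limsup_bounded)
    define L0 where "L0 = max (real n0) (max 1 (g / e))"
    have "ln (real (covering_number S \<delta>)) / - ln \<delta> \<le> g + e" if \<delta>: "0 < \<delta>" "\<delta> < 2 powr (- L0)" for \<delta>
    proof -
      define L where "L = log 2 (1 / \<delta>)"
      have pL: "2 powr L = 1 / \<delta>" using \<delta> by (simp add: L_def)
      have "- L0 > log 2 \<delta>" using \<delta> by (subst log_less_iff) auto
      then have L: "real n0 < L" "1 < L" "g / e < L" using \<delta> by (auto simp: L_def L0_def log_divide)
      define n where "n = nat \<lceil>L\<rceil>"
      have n: "L \<le> real n" "real n \<le> L + 1" using L by (simp_all add: n_def)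
      have "(1 / 2) ^ n \<le> \<delta>"
      proof -
        have "1 / \<delta> \<le> 2 powr real n" unfolding pL[symmetric] using n by simp
        then have "1 / \<delta> \<le> 2 ^ n" by (simp add: powr_realpow)
        then show ?thesis using \<delta> by (simp add: power_one_over field_simps)
      qed
      have "n0 \<le> n" using L(1) n(1) by linarith
      then obtain C where C: "finite C" "S \<subseteq> \<Union>C" "\<And>U. U \<in> C \<Longrightarrow> bounded U \<and> diameter U \<le> (1 / 2) ^ n"
        "real (card C) \<le> 2 powr (real n * g)"
        using n0 unfolding small_cover_def by metis
      have "covering_number S \<delta> \<le> card C"
        unfolding covering_number_def using C \<open>(1 / 2) ^ n \<le> \<delta>\<close>
        by (intro cInf_lower) (auto intro!: exI[of _ C] intro: order.trans)
      then have N: "real (covering_number S \<delta>) \<le> 2 powr (real n * g)" using C(4) by linarith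
      have "ln (real (covering_number S \<delta>)) \<le> real n * g * ln 2"
      \<comment> \<open>Monotonicity of \<open>ln\<close> needs a positive argument; otherwise
        \<open>ln 0 = 0\<close> is below the nonnegative right side.\<close>
      proof (cases "covering_number S \<delta> = 0")
        case False
        then have "ln (real (covering_number S \<delta>)) \<le> ln (2 powr (real n * g))" using N by (subst ln_le_cancel_iff) auto
        then show ?thesis by (simp add: ln_powr)
      qed (use g in simp)
      also have "\<dots> \<le> (L + 1) * g * ln 2" using n(2) g by (intro mult_right_mono) auto
      also have "\<dots> \<le> (g + e) * (L * ln 2)"
      proof -
        have "g \<le> e * L" using L(3) e by (simp add: field_simps)
        then have "(L + 1) * g \<le> (g + e) * L" by (simp add: algebra_simps)
        then show ?thesis by (simp add: mult.assoc[symmetric] mult_right_mono)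
      qed
      also have "L * ln 2 = - ln \<delta>" using \<delta> by (simp add: L_def log_def ln_div)
      finally have "ln (real (covering_number S \<delta>)) \<le> (g + e) * - ln \<delta>" .
      moreover have "0 < - ln \<delta>"
        using \<open>L * ln 2 = - ln \<delta>\<close> L(2) by (metis ln_gt_zero_iff mult_pos_pos one_less_numeral_iff order.strict_trans semiring_norm(76) zero_less_one)
      ultimately show ?thesis by (subst pos_divide_le_eq)
    qed
    then have "\<forall>\<delta>>0. \<delta> < 2 powr (- L0) \<longrightarrow> ereal (ln (real (covering_number S \<delta>)) / - ln \<delta>) \<le> ereal g + ereal e" by simp
    then show "\<forall>\<^sub>F \<delta> in at_right 0. ereal (ln (real (covering_number S \<delta>)) / - ln \<delta>) \<le> ereal g + ereal e"
      unfolding eventually_at_right_field by (intro exI[of _ "2 powr (- L0)"]) simp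
  qed
  then show ?thesis using False unfolding upper_box_dim_def by (simp add: ereal_le_epsilon2)
qed (simp add: upper_box_dim_def)

lemma cone_exponent_half: "cone_exponent (1 / 2) = ball_cutout_alpha r TYPE('a)"
  by (simp add: cone_exponent_def ball_cutout_alpha_def content_ball)

text \<open>Three errors below \<open>e / 3\<close> each: a rational \<open>s\<close> above the
  dimension, \<open>\<beta> j\<close> close to 1/2, and \<open>\<epsilon> j\<close>. They range over
  countable families, so one null set is fixed before \<open>E\<close>, \<open>j\<close> and
  \<open>s\<close> are chosen.\<close>

lemma AE_upper_box_dim:
  "AE \<omega> in M. \<forall>E :: 'a set. self_similar_osc E \<and> hausdorff_dim E > ball_cutout_alpha r TYPE('a) \<longrightarrow>
     upper_box_dim (E \<inter> cutout_A (Y \<omega>)) \<le> ereal (hausdorff_dim E - ball_cutout_alpha r TYPE('a))"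
proof -
  define \<alpha> where "\<alpha> = ball_cutout_alpha r TYPE('a)"
  \<comment> \<open>The shift by 3 keeps every \<open>\<beta> j\<close> in [1/6, 1/2).\<close>
  define \<beta> where "\<beta> j = 1 / 2 - 1 / (real j + 3)" for j :: nat
  define \<epsilon> where "\<epsilon> j = 1 / (real j + 1)" for j :: nat
  have \<beta>: "0 \<le> \<beta> j" "\<beta> j < 1 / 2" for j by (auto simp: \<beta>_def field_simps)
  have \<epsilon>: "0 < \<epsilon> j" for j by (simp add: \<epsilon>_def)
  have "AE \<omega> in M. \<forall>m (K :: nat) (j :: nat) (s :: rat). 1 \<le> K \<and> 0 \<le> real_of_rat s \<and> cone_exponent (\<beta> j) \<le> real_of_rat s \<longrightarrow>
     (\<forall>E. ss_class m (real K) (real_of_rat s) E \<longrightarrow> (\<forall>\<^sub>F n in sequentially.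
     small_cover (E \<inter> cutout_A (Y \<omega>)) ((1 / 2) ^ n) (2 powr (real n * (real_of_rat s - cone_exponent (\<beta> j) + \<epsilon> j)))))"
    unfolding AE_all_countable
  proof (intro allI)
    fix m K j :: nat and s :: rat
    show "AE \<omega> in M. 1 \<le> K \<and> 0 \<le> real_of_rat s \<and> cone_exponent (\<beta> j) \<le> real_of_rat s \<longrightarrow>
     (\<forall>E. ss_class m (real K) (real_of_rat s) E \<longrightarrow> (\<forall>\<^sub>F n in sequentially.
     small_cover (E \<inter> cutout_A (Y \<omega>)) ((1 / 2) ^ n) (2 powr (real n * (real_of_rat s - cone_exponent (\<beta> j) + \<epsilon> j)))))"
    proof (cases "1 \<le> K \<and> 0 \<le> real_of_rat s \<and> cone_exponent (\<beta> j) \<le> real_of_rat s")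
      case True
      have "AE \<omega> in M. \<forall>E. ss_class m (real K) (real_of_rat s) E \<longrightarrow> (\<forall>\<^sub>F n in sequentially.
        small_cover (E \<inter> cutout_A (Y \<omega>)) ((1 / 2) ^ n) (2 powr (real n * (real_of_rat s - cone_exponent (\<beta> j) + \<epsilon> j))))"
        using True \<beta>[of j] \<epsilon>[of j] by (intro AE_small_cover) auto
      then show ?thesis by (rule eventually_mono) (rule impI)
    next
      case False
      show ?thesis by (rule AE_I2, rule impI) (use False in blast)
    qed
  qed
  then show ?thesis
    unfolding \<alpha>_def[symmetric]
  proof (rule eventually_mono)
    fix \<omega>
    assume *: "\<forall>m (K :: nat) (j :: nat) (s :: rat). 1 \<le> K \<and> 0 \<le> real_of_rat s \<and> cone_exponent (\<beta> j) \<le> real_of_rat s \<longrightarrow>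
     (\<forall>E. ss_class m (real K) (real_of_rat s) E \<longrightarrow> (\<forall>\<^sub>F n in sequentially.
     small_cover (E \<inter> cutout_A (Y \<omega>)) ((1 / 2) ^ n) (2 powr (real n * (real_of_rat s - cone_exponent (\<beta> j) + \<epsilon> j)))))"
    show "\<forall>E :: 'a set. self_similar_osc E \<and> \<alpha> < hausdorff_dim E \<longrightarrow>
      upper_box_dim (E \<inter> cutout_A (Y \<omega>)) \<le> ereal (hausdorff_dim E - \<alpha>)"
    proof (intro allI impI, elim conjE)
      fix E :: "'a set" assume E: "self_similar_osc E" "\<alpha> < hausdorff_dim E"
      have "upper_box_dim (E \<inter> cutout_A (Y \<omega>)) \<le> ereal (hausdorff_dim E - \<alpha>) + ereal e" if e: "0 < e" for e
      proof -
        have "(\<lambda>j. cone_exponent (\<beta> j)) \<longlonglongrightarrow> cone_exponent (1 / 2 - 0)"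
          unfolding cone_exponent_def \<beta>_def by (intro tendsto_intros) real_asymp
        then have "\<forall>\<^sub>F j in sequentially. \<alpha> - e / 3 < cone_exponent (\<beta> j)"
          using e by (intro order_tendstoD(1)) (auto simp: cone_exponent_half \<alpha>_def)
        moreover have "\<epsilon> \<longlonglongrightarrow> 0" unfolding \<epsilon>_def[abs_def] by real_asymp
        then have "\<forall>\<^sub>F j in sequentially. \<epsilon> j < e / 3" using e by (intro order_tendstoD(2)) auto
        ultimately have "\<forall>\<^sub>F j in sequentially. \<alpha> - e / 3 < cone_exponent (\<beta> j) \<and> \<epsilon> j < e / 3"
          by eventually_elim simp
        then obtain j where j: "\<alpha> - e / 3 < cone_exponent (\<beta> j)" "\<epsilon> j < e / 3"
          using eventually_happens sequentially_bot by blast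
        obtain s where s: "hausdorff_dim E < real_of_rat s" "real_of_rat s < hausdorff_dim E + e / 3"
          using of_rat_dense[of "hausdorff_dim E" "hausdorff_dim E + e / 3"] e by auto
        have le: "cone_exponent (\<beta> j) \<le> \<alpha>"
          unfolding \<alpha>_def cone_exponent_half[symmetric] cone_exponent_def
          using \<beta>[of j] r by (intro mult_left_mono power_mono) auto
        have "0 \<le> cone_exponent (\<beta> j)" using cone_exponent_nonneg[OF \<beta>(1)] .
        then have s0: "0 \<le> real_of_rat s" "cone_exponent (\<beta> j) \<le> real_of_rat s" using le E(2) s(1) by linarith+
        obtain m K where K: "1 \<le> (K::nat)" "ss_class m (real K) (real_of_rat s) E"
          using self_similar_osc_class[OF E(1), of "real_of_rat s"] s(1) by auto
        have "\<forall>\<^sub>F n in sequentially. small_cover (E \<inter> cutout_A (Y \<omega>)) ((1 / 2) ^ n)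
            (2 powr (real n * (real_of_rat s - cone_exponent (\<beta> j) + \<epsilon> j)))"
          using *[rule_format, OF _ K(2)] K(1) s0 by simp
        then have "upper_box_dim (E \<inter> cutout_A (Y \<omega>)) \<le> ereal (real_of_rat s - cone_exponent (\<beta> j) + \<epsilon> j)"
          using s0 \<epsilon>[of j] by (intro small_cover_upper_box_dim) auto
        also have "\<dots> \<le> ereal (hausdorff_dim E - \<alpha>) + ereal e" using s(2) j by simp
        finally show ?thesis .
      qed
      then show "upper_box_dim (E \<inter> cutout_A (Y \<omega>)) \<le> ereal (hausdorff_dim E - \<alpha>)"
        by (rule ereal_le_epsilon2)
    qed
  qed
qed

end

theorem theorem11p7:
  fixes M :: "'w measure" and Y :: "'w \<Rightarrow> ((real ^ ('d::finite)) \<times> real) set" and r :: real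
  assumes "0 < r"
    and "ball_cutout_alpha r TYPE(real ^ 'd) < real CARD('d)"
    and "poisson_point_process M (ball_cutout_intensity r) Y"
  shows "AE \<omega> in M. \<forall>E :: (real ^ 'd) set.
           self_similar_osc E \<and> hausdorff_dim E > ball_cutout_alpha r TYPE(real ^ 'd) \<longrightarrow>
           upper_box_dim (E \<inter> cutout_A (Y \<omega>))
             \<le> ereal (hausdorff_dim E - ball_cutout_alpha r TYPE(real ^ 'd))"
proof -
  interpret ball_cutout M Y r by unfold_locales (fact assms(1,3))+
  show ?thesis by (rule AE_upper_box_dim)
qed

end
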